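(* Let $F|K$ be an arbitrary field extension and $L|K$ an algebraic extension (with $L$, and the element $b$ below, contained in a fixed algebraic closure of $F$). Then the following hold. 1) Assume that $K$ is relatively algebraically closed in $F$ and $b$ is algebraic over $K$, or that $K$ is relatively separable-algebraically closed in $F$ and $b$ is separable-algebraic over $K$. Then $F$ and $K(b)$ are linearly disjoint over $K$. 2) Assume that $K$ is relatively separable-algebraically closed in $F$ and $L|K$ is separable-algebraic. Then $F$ and $L$ are linearly disjoint over $K$. 3) Assume that $K$ is relatively algebraically closed in $F$ and $L|K$ is separable-algebraic. Then $L$ is relatively algebraically closed in $L.F$. 4) Assume that $K$ is relatively separable-algebraically closed in $F$ and $L|K$ is algebraic. Then $L$ is relatively separable-algebraically closed in $L.F$.
   Context: The characteristic is arbitrary. For algebraic extensions $L|K$, the compositum $L.F$ denotes the smallest subfield containing $L$ and $F$ inside a fixed algebraic closure of $F$. A field $K$ is relatively algebraically closed in an extension field $F$ if every element of $F$ that is algebraic over $K$ lies in $K$. It is relatively separable-algebraically closed in $F$ if every element of $F$ that is separable-algebraic (i.e., algebraic and separable) over $K$ lies in $K$. *)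

theory Defs
  imports "HOL-Algebra.Algebraic_Closure" "HOL-Algebra.Generated_Fields"
begin

text \<open>
  All fields are subfields, given by their carrier sets, of one ambient field. In the main
  statement the ambient field is an algebraic closure of \<open>F\<close>.
\<close>

context ring
begin

definition algebraic_ext :: "'a set \<Rightarrow> 'a set \<Rightarrow> bool"
  where "algebraic_ext K L \<longleftrightarrow> K \<subseteq> L \<and> (\<forall>x\<in>L. (algebraic over K) x)"

definition rel_alg_closed :: "'a set \<Rightarrow> 'a set \<Rightarrow> bool"
  where "rel_alg_closed K F \<longleftrightarrow> (\<forall>x\<in>F. (algebraic over K) x \<longrightarrow> x \<in> K)"

text \<open>
  This is the usual one-sided formulation of linear disjointness (e.g. in Lang's \<open>Algebra\<close>);
  the relation is well known to be symmetric in \<open>E\<close> and \<open>E'\<close>. A family of elements is a list;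
  \<^const>\<open>independent\<close> excludes repetitions.
\<close>

definition linearly_disjoint :: "'a set \<Rightarrow> 'a set \<Rightarrow> 'a set \<Rightarrow> bool"
  where "linearly_disjoint K E E' \<longleftrightarrow>
    (\<forall>us. set us \<subseteq> E \<longrightarrow> independent K us \<longrightarrow> independent E' us)"

end

context algebraically_closed
begin

text \<open>
  An algebraic element is separable over \<open>K\<close> iff its minimal polynomial over \<open>K\<close> has no multiple
  root in an algebraic closure. Here \<^const>\<open>alg_mult\<close> counts roots in the ambient field, so the
  definition is only adequate because that field is algebraically closed.
\<close>

definition separable_algebraic :: "'a set \<Rightarrow> 'a \<Rightarrow> bool"
  where "separable_algebraic K x \<longleftrightarrow>
    (algebraic over K) x \<and> (\<forall>a\<in>carrier L. alg_mult (Irr K x) a \<le> 1)"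

definition separable_algebraic_ext :: "'a set \<Rightarrow> 'a set \<Rightarrow> bool"
  where "separable_algebraic_ext K E \<longleftrightarrow> K \<subseteq> E \<and> (\<forall>x\<in>E. separable_algebraic K x)"

definition rel_sep_alg_closed :: "'a set \<Rightarrow> 'a set \<Rightarrow> bool"
  where "rel_sep_alg_closed K F \<longleftrightarrow> (\<forall>x\<in>F. separable_algebraic K x \<longrightarrow> x \<in> K)"

end

end

theory Submission
  imports Defs "HOL-Computational_Algebra.Primes"
begin

text \<open>
  The argument uses linear algebra and the Frobenius map \<open>\<phi> x = x^p\<close>, where \<open>p\<close> is the
  characteristic exponent (so \<open>\<phi>\<close> is the identity in characteristic zero).

  \<^item> \<^emph>\<open>Separability.\<close> An algebraic element \<open>x\<close> is separable over \<open>K\<close> iff \<open>x \<in> K[\<phi> x]\<close>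
    (\<open>separable_algebraic_iff_frob_sep\<close>). If \<open>E = K[xs]\<close> is generated by such elements, the
    \<open>K\<close>-span of the \<open>\<phi>\<close>-image of a basis of \<open>E\<close> is a ring that contains \<open>K\<close> and all \<open>\<phi> x\<close>,
    hence it contains \<open>E\<close>; by counting dimensions, \<open>\<phi>\<close> preserves linear independence over \<open>K\<close>
    inside \<open>E\<close> (\<open>frob_preserves_independent\<close>). It follows that the separable elements form a
    subfield \<open>S\<close>, that separability is transitive, and, because the fields \<open>K[\<phi>^n x]\<close> decrease,
    that every algebraic element has an iterate \<open>\<phi>^n x\<close> in \<open>S\<close>.

  \<^item> \<^emph>\<open>Simple extensions.\<close> The minimal polynomial of \<open>b\<close> over \<open>F\<close> has its roots among the
    \<open>K\<close>-conjugates of \<open>b\<close>, so its coefficients are algebraic over \<open>K\<close> (separable if \<open>b\<close> is). They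
    also lie in \<open>F\<close>, hence in \<open>K\<close>. So the degree of \<open>b\<close> does not drop and the powers of \<open>b\<close> that
    form a \<open>K\<close>-basis of \<open>K[b]\<close> stay independent over \<open>F\<close>.

  \<^item> \<^emph>\<open>Separable extensions.\<close> Adjoin finitely many separable generators one at a time. The
    step from \<open>(K, F)\<close> to \<open>(K[b], F[b])\<close> keeps the hypothesis of relative closedness: if
    \<open>a = f(b)\<close> with \<open>f\<close> over \<open>F\<close> is separable over \<open>K\<close>, then \<open>f\<close> takes separable values at the
    distinct conjugates of \<open>b\<close>, and by interpolation its coefficients lie in \<open>S \<inter> F = K\<close>.

  \<^item> \<^emph>\<open>Composita.\<close> Let \<open>a\<close> in \<open>L.F\<close> be algebraic over \<open>L\<close>; it is an \<open>F\<close>-combination of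
    elements \<open>l\<^sub>i\<close> of \<open>L\<close>. Apply \<open>\<phi>^n\<close> so that \<open>a\<close> and the \<open>l\<^sub>i\<close> become separable over \<open>K\<close>.
    Linear disjointness of \<open>S\<close> and \<open>F\<close> makes \<open>\<phi>^n a\<close> a \<open>K\<close>-combination of the \<open>\<phi>^n l\<^sub>i\<close>, so
    \<open>\<phi>^n a \<in> L\<close>. If \<open>a\<close> is separable over \<open>L\<close>, then \<open>a \<in> L\<close>. If instead \<open>L\<close> is separable over
    \<open>K\<close>, choose the \<open>l\<^sub>i\<close> independent over \<open>K\<close>; the \<open>\<phi>^n l\<^sub>i\<close> are then independent over \<open>F\<close>, so
    the coefficients \<open>f\<^sub>i\<close> of \<open>a\<close> satisfy \<open>\<phi>^n f\<^sub>i \<in> K\<close>. They are algebraic over \<open>K\<close>, hence in \<open>K\<close>.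
\<close>

section \<open>The Frobenius endomorphism\<close>

text \<open>
  The characteristic exponent: the characteristic if that is positive, and 1 otherwise. With this
  convention the results on \<open>frob\<close> hold in every characteristic.
\<close>

definition (in ring) char_exp :: nat
  where "char_exp =
    (if \<exists>n>0::nat. [n] \<cdot> \<one> = \<zero> then LEAST n::nat. n > 0 \<and> [n] \<cdot> \<one> = \<zero> else 1)"

definition (in ring) frob :: "'a \<Rightarrow> 'a"
  where "frob x = x [^] char_exp"

lemma (in domain) char_exp_cases:
  obtains (zero) "char_exp = 1" "\<And>n::nat. n > 0 \<Longrightarrow> [n] \<cdot> \<one> \<noteq> \<zero>"
  | (prime) "normalization_semidom_class.prime char_exp" "[char_exp] \<cdot> \<one> = \<zero>"
proof (cases "\<exists>n>0::nat. [n] \<cdot> \<one> = \<zero>")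
  case False
  then have "char_exp = 1" unfolding char_exp_def by (rule if_not_P)
  then show thesis using zero False by blast
next
  case True
  define p where "p = char_exp"
  have p: "p > 0" "[p] \<cdot> \<one> = \<zero>"
    using LeastI_ex[of "\<lambda>n::nat. n > 0 \<and> [n] \<cdot> \<one> = \<zero>"] True by (auto simp: p_def char_exp_def)
  have least: "p \<le> n" if "n > 0" "[n] \<cdot> \<one> = \<zero>" for n
    using Least_le[of "\<lambda>n::nat. n > 0 \<and> [n] \<cdot> \<one> = \<zero>" n] True that by (auto simp: p_def char_exp_def)
  have "p \<noteq> 1" using p(2) by auto
  have "normalization_semidom_class.prime p"
  proof (rule ccontr)
    assume "\<not> normalization_semidom_class.prime p"
    then obtain a where a: "a dvd p" "a \<noteq> 1" "a \<noteq> p"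
      using p(1) \<open>p \<noteq> 1\<close> by (auto simp: prime_nat_iff)
    obtain b where b: "p = a * b" using a(1) unfolding dvd_def by blast
    have pos: "0 < a" "0 < b" using b p(1) by (auto intro!: Nat.gr0I)
    have lt: "a < p" "b < p"
      using a dvd_imp_le[OF a(1) p(1)] pos b n_less_m_mult_n[of b a] by auto
    have "[(a * b)] \<cdot> \<one> = [a] \<cdot> \<one> \<otimes> [b] \<cdot> \<one>"
      using add_pow_ldistr[of \<one> "[b] \<cdot> \<one>" a] add.nat_pow_pow[of \<one> a b]
      by (simp add: mult.commute)
    then have "[a] \<cdot> \<one> = \<zero> \<or> [b] \<cdot> \<one> = \<zero>"
      using p(2) b integral by simp
    then show False using least[of a] least[of b] pos lt by linarith
  qed
  then show thesis using prime p(2) by (auto simp: p_def)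
qed

lemma (in domain) char_exp_pos: "char_exp > 0"
  by (rule char_exp_cases) (simp_all add: prime_gt_0_nat)

lemma (in cring) binomial_expansion:
  assumes x: "x \<in> carrier R" and y: "y \<in> carrier R"
  shows "(x \<oplus> y) [^] n = (\<Oplus>k\<in>{..n}. [(n choose k)] \<cdot> (x [^] k \<otimes> y [^] (n - k)))"
proof (induction n)
  case 0
  then show ?case by simp
next
  case (Suc n)
  define t where "t = (\<lambda>n k::nat. [(n choose k)] \<cdot> (x [^] k \<otimes> y [^] (n - k)))"
  have t[simp]: "t n k \<in> carrier R" for n k using x y by (simp add: t_def)
  have pascal: "t (Suc n) (Suc k) = x \<otimes> t n k \<oplus> y \<otimes> t n (Suc k)" if "k \<le> n" for k
  proof -
    define z where "z = x [^] Suc k \<otimes> y [^] (n - k)"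
    have z: "z \<in> carrier R" using x y by (simp add: z_def)
    have 1: "x \<otimes> t n k = [(n choose k)] \<cdot> z"
    proof -
      have "x \<otimes> (x [^] k \<otimes> y [^] (n - k)) = z"
        using x y by (simp add: z_def m_ac)
      then show ?thesis using x y by (simp add: t_def add_pow_rdistr)
    qed
    have 2: "y \<otimes> t n (Suc k) = [(n choose Suc k)] \<cdot> z"
    proof (cases "k = n")
      case True
      then show ?thesis using x y z by (simp add: t_def binomial_eq_0)
    next
      case False
      then have "n - k = Suc (n - Suc k)" using that by simp
      then have "y \<otimes> (x [^] Suc k \<otimes> y [^] (n - Suc k)) = z"
        using x y by (simp add: z_def m_ac)
      then show ?thesis using x y by (simp add: t_def add_pow_rdistr)
    qed
    have "t (Suc n) (Suc k) = [(Suc n choose Suc k)] \<cdot> z"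
      by (simp only: t_def z_def diff_Suc_Suc)
    then show ?thesis
      unfolding 1 2 using z by (simp add: add.nat_pow_mult)
  qed
  have zero_top: "t n (Suc n) = \<zero>" by (simp add: t_def binomial_eq_0)
  define P where "P = (\<Oplus>k\<in>{..n}. t n k)"
  have P: "P \<in> carrier R" by (simp add: P_def)
  have "(\<Oplus>k\<in>{..Suc n}. t (Suc n) k) = (\<Oplus>k\<in>{..n}. t (Suc n) (Suc k)) \<oplus> t (Suc n) 0"
    by (simp add: finsum_Suc2 del: finsum_Suc)
  also have "t (Suc n) 0 = y \<otimes> t n 0"
    using x y by (simp add: t_def m_comm)
  also have "(\<Oplus>k\<in>{..n}. t (Suc n) (Suc k)) = (\<Oplus>k\<in>{..n}. x \<otimes> t n k \<oplus> y \<otimes> t n (Suc k))"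
    using x y pascal by (intro finsum_cong') auto
  also have "\<dots> = x \<otimes> P \<oplus> y \<otimes> (\<Oplus>k\<in>{..n}. t n (Suc k))"
    using x y by (simp add: P_def finsum_addf finsum_rdistr Pi_def)
  also have "x \<otimes> P \<oplus> y \<otimes> (\<Oplus>k\<in>{..n}. t n (Suc k)) \<oplus> y \<otimes> t n 0
      = x \<otimes> P \<oplus> y \<otimes> ((\<Oplus>k\<in>{..n}. t n (Suc k)) \<oplus> t n 0)"
    using x y P by (simp add: r_distr a_assoc)
  also have "(\<Oplus>k\<in>{..n}. t n (Suc k)) \<oplus> t n 0 = (\<Oplus>k\<in>{..Suc n}. t n k)"
    by (simp add: finsum_Suc2 del: finsum_Suc)
  also have "\<dots> = P"
    using P by (simp add: zero_top P_def)
  also have "x \<otimes> P \<oplus> y \<otimes> P = (x \<oplus> y) [^] Suc n"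
    using Suc.IH x y P by (simp add: P_def t_def l_distr m_comm)
  finally show ?case by (simp add: t_def)
qed

lemma (in cring) freshmans_dream:
  assumes p: "normalization_semidom_class.prime (p::nat)" "[p] \<cdot> \<one> = \<zero>"
    and x: "x \<in> carrier R" and y: "y \<in> carrier R"
  shows "(x \<oplus> y) [^] p = x [^] p \<oplus> y [^] p"
proof -
  have p0: "[p] \<cdot> a = \<zero>" if "a \<in> carrier R" for a
    using add_pow_ldistr[of \<one> a p] that p(2) by simp
  have mid: "[(p choose k)] \<cdot> a = \<zero>" if "0 < k" "k < p" "a \<in> carrier R" for a k
  proof -
    have "p dvd (p choose k)"
      using p(1) that by (intro dvd_choose_prime) auto
    then obtain q where "p choose k = p * q" ..
    then show ?thesis
      using that p0[of a] add.nat_pow_pow[of a q p] by (simp add: mult.commute)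
  qed
  define f where "f = (\<lambda>k. [(p choose k)] \<cdot> (x [^] k \<otimes> y [^] (p - k)))"
  have f: "f k \<in> carrier R" for k using x y by (simp add: f_def)
  obtain m where m: "p = Suc (Suc m)"
    using prime_ge_2_nat[OF p(1)] by (metis add_2_eq_Suc le_Suc_ex)
  have "(x \<oplus> y) [^] p = (\<Oplus>k\<in>{..Suc (Suc m)}. f k)"
    using binomial_expansion[OF x y, of p] by (simp add: f_def m)
  also have "\<dots> = f p \<oplus> ((\<Oplus>k\<in>{..m}. f (Suc k)) \<oplus> f 0)"
    using f finsum_Suc[of f "Suc m"] finsum_Suc2[of f m] by (simp add: Pi_def m)
  also have "(\<Oplus>k\<in>{..m}. f (Suc k)) = (\<Oplus>k\<in>{..m}. \<zero>)"
  proof (intro finsum_cong')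
    fix i assume "i \<in> {..m}"
    then show "f (Suc i) = \<zero>"
      unfolding f_def using x y m by (intro mid) auto
  qed auto
  finally show ?thesis
    using x y by (simp add: f_def add.nat_pow_eone)
qed

lemma (in domain) frob_ring_hom: "frob \<in> ring_hom R R"
proof (rule ring_hom_memI)
  fix x y assume xy: "x \<in> carrier R" "y \<in> carrier R"
  show "frob (x \<otimes> y) = frob x \<otimes> frob y"
    using xy by (simp add: frob_def nat_pow_distrib)
  show "frob (x \<oplus> y) = frob x \<oplus> frob y"
  proof (cases rule: char_exp_cases)
    case zero then show ?thesis using xy by (simp add: frob_def)
  next
    case prime then show ?thesis using xy freshmans_dream by (simp add: frob_def)
  qed
qed (auto simp: frob_def)

lemma (in domain) frob_funpow_ring_hom: "frob ^^ n \<in> ring_hom R R"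
proof (induction n)
  case 0
  show ?case by (rule ring_hom_memI) auto
next
  case (Suc n)
  then show ?case using ring_hom_trans[OF Suc frob_ring_hom] by (simp add: comp_def)
qed

lemma (in ring) frob_closed [simp, intro]: "x \<in> carrier R \<Longrightarrow> frob x \<in> carrier R"
  by (simp add: frob_def)

lemma (in ring) frob_funpow_closed [simp, intro]: "x \<in> carrier R \<Longrightarrow> (frob ^^ n) x \<in> carrier R"
  by (induction n) auto

lemma (in ring) frob_mem_subring:
  assumes "subring K R" "x \<in> K" shows "frob x \<in> K"
proof -
  have "x [^] (n::nat) \<in> K" for n
    using assms by (induction n) (simp_all add: subringE(3,6))
  then show ?thesis by (simp add: frob_def)
qed

lemma (in ring) frob_funpow_mem_subring:
  assumes "subring K R" "x \<in> K" shows "(frob ^^ n) x \<in> K"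
  using assms frob_mem_subring by (induction n) auto

section \<open>Linear algebra over subfields\<close>

declare (in ring) Span.simps [simp del]

lemma (in ring) Span_Nil [simp]: "Span K [] = {\<zero>}"
  by (simp add: Span.simps)

lemma (in ring) Span_Cons_mem_iff:
  "x \<in> Span K (u # us) \<longleftrightarrow> (\<exists>k\<in>K. \<exists>v\<in>Span K us. x = k \<otimes> u \<oplus> v)"
  by (simp add: line_extension_mem_iff Span.simps)

lemma (in ring) Span_mono_subset:
  assumes "K \<subseteq> K'" shows "Span K us \<subseteq> Span K' us"
proof (induction us)
  case Nil
  then show ?case by simp
next
  case (Cons u us)
  then show ?case
    unfolding subset_iff Span_Cons_mem_iff using assms by blast
qed

lemma (in ring) independent_mono:
  assumes "K \<subseteq> K'" and "independent K' us" shows "independent K us"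
  using assms(2)
proof (induction us rule: list.induct)
  case Nil
  show ?case by (rule li_Nil)
next
  case (Cons u us)
  then show ?case
    using independent_backwards[OF Cons.prems] Span_mono_subset[OF assms(1), of us]
    by (blast intro: li_Cons)
qed

text \<open>
  Used in contrapositive form: a family whose length does not exceed the dimension of its span is
  independent.
\<close>

lemma (in ring) dependent_imp_Span_dimension_less:
  assumes K: "subfield K R" and us: "set us \<subseteq> carrier R" and dep: "dependent K us"
  obtains m where "m < length us" "dimension m K (Span K us)"
proof -
  have *: "\<exists>m\<le>length us. dimension m K (Span K us) \<and> (dependent K us \<longrightarrow> m < length us)"
    using us
  proof (induction us)
    case (Cons u us)
    then obtain m where m: "m \<le> length us" "dimension m K (Span K us)"
      "dependent K us \<longrightarrow> m < length us" by auto
    show ?case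
    proof (cases "u \<in> Span K us")
      case True
      then have "set (u # us) \<subseteq> Span K us"
        using Span_base_incl[OF K, of us] Cons.prems by auto
      then have "Span K (u # us) = Span K us"
        using mono_Span_subset[OF K, of "u # us" us] mono_Span[OF K, of us u] Cons.prems by auto
      then show ?thesis using m by (intro exI[of _ m]) auto
    next
      case False
      then have "dimension (Suc m) K (Span K (u # us))"
        using m(2) Cons.prems False using Suc_dim[of u "Span K us" m K] by (simp add: Span.simps)
      moreover have "dependent K us" if "dependent K (u # us)"
        using that False Cons.prems li_Cons by auto
      ultimately show ?thesis using m by (intro exI[of _ "Suc m"]) auto
    qed
  qed auto
  then show thesis using that dep by blast
qed

lemma (in ring) combine_mem:
  assumes "subring E R" and "set ks \<subseteq> E" and "set us \<subseteq> E"
  shows "combine ks us \<in> E"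
  using assms(2,3)
  by (induction ks us rule: combine.induct) (auto intro: subringE[OF assms(1)])

lemma (in cring) combine_linear_coeffs:
  assumes "set us \<subseteq> carrier R" "v \<in> carrier R"
    and "\<And>c. c \<in> set cs \<Longrightarrow> f c \<in> carrier R" "\<And>c. c \<in> set cs \<Longrightarrow> g c \<in> carrier R"
    and "\<And>c. c \<in> set cs \<Longrightarrow> f c \<otimes> v \<oplus> g c = c"
  shows "combine cs us = combine (map f cs) us \<otimes> v \<oplus> combine (map g cs) us"
  using assms(1,3,4,5)
proof (induction cs us rule: combine.induct)
  case (1 c cs u us)
  define A B where "A = combine (map f cs) us" and "B = combine (map g cs) us"
  have AB: "A \<in> carrier R" "B \<in> carrier R"
    unfolding A_def B_def using 1 by (auto intro!: combine_in_carrier)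
  have carr: "f c \<in> carrier R" "g c \<in> carrier R" "u \<in> carrier R"
    using 1 by auto
  have "combine (c # cs) (u # us) = (f c \<otimes> v \<oplus> g c) \<otimes> u \<oplus> (A \<otimes> v \<oplus> B)"
    using 1 by (simp add: A_def B_def)
  also have "\<dots> = (f c \<otimes> u \<oplus> A) \<otimes> v \<oplus> (g c \<otimes> u \<oplus> B)"
    using carr AB assms(2) by algebra
  finally show ?case by (simp add: A_def B_def)
qed (use assms(2) in auto)

text \<open>
  The core of the symmetry of linear disjointness. Expand the coefficients \<open>cs\<close> of a relation
  among the \<open>us\<close> in terms of \<open>vs\<close> and reorder: this gives a relation among the \<open>vs\<close> whose
  coefficients are the \<open>K\<close>-combinations of the \<open>us\<close>. These vanish since \<open>vs\<close> is independent over
  \<open>E\<close>, and then so do the coordinates of the \<open>cs\<close>. The induction peels off one \<open>v\<close> at a time to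
  avoid double sums.
\<close>

lemma (in domain) independent_imp_trivial_combine_sym:
  assumes K: "subfield K R" and E: "subfield E R" and KE: "K \<subseteq> E"
    and us: "set us \<subseteq> E" "independent K us"
    and "independent E vs" and "set cs \<subseteq> Span K vs" and "combine cs us = \<zero>"
  shows "set (take (length us) cs) \<subseteq> {\<zero>}"
  using assms(6-)
proof (induction vs arbitrary: cs rule: list.induct)
  case Nil
  then show ?case by (auto dest: in_set_takeD)
next
  case (Cons v vs)
  note E_sub = subfieldE(1)[OF E]
  have v: "v \<in> carrier R" "v \<notin> Span E vs" and vs: "independent E vs"
    using independent_backwards[OF Cons.prems(1)] by auto
  have vs_carr: "set vs \<subseteq> carrier R" using vs independent_in_carrier by blast
  have us_carr: "set us \<subseteq> carrier R" using us(2) independent_in_carrier by blast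
  have "\<forall>c\<in>set cs. \<exists>k w. k \<in> K \<and> w \<in> Span K vs \<and> k \<otimes> v \<oplus> w = c"
    using Cons.prems(2) unfolding subset_iff Span_Cons_mem_iff by metis
  then obtain f g where fg: "\<And>c. c \<in> set cs \<Longrightarrow> f c \<in> K \<and> g c \<in> Span K vs \<and> f c \<otimes> v \<oplus> g c = c"
    by metis
  have K_carr: "K \<subseteq> carrier R" and Span_carr: "Span K vs \<subseteq> carrier R"
    using subfieldE(3)[OF K] Span_in_carrier vs_carr by auto
  define e w where "e = combine (map f cs) us" and "w = combine (map g cs) us"
  have eq: "e \<otimes> v \<oplus> w = \<zero>"
    unfolding e_def w_def Cons.prems(3)[symmetric]
    using us_carr v(1) fg K_carr Span_carr by (intro combine_linear_coeffs[symmetric]) auto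
  have e: "e \<in> E"
    unfolding e_def using fg KE us(1) by (intro combine_mem E_sub) auto
  have w: "w \<in> Span E vs"
  proof -
    have *: "set ks \<subseteq> Span E vs \<Longrightarrow> set ys \<subseteq> E \<Longrightarrow> combine ks ys \<in> Span E vs" for ks ys
    proof (induction ks ys rule: combine.induct)
      case (1 k ks y ys)
      have "k \<otimes> y = y \<otimes> k"
        using 1 Span_in_carrier[OF subfieldE(3)[OF E] vs_carr] subfieldE(3)[OF E]
        by (intro m_comm) auto
      then show ?case using 1 E vs_carr by auto
    qed (use E vs_carr in auto)
    then show ?thesis
      unfolding w_def using fg Span_mono_subset[OF KE, of vs] by (intro * us(1)) auto
  qed
  have carr: "e \<in> carrier R" "w \<in> carrier R"
    using e w E_sub vs_carr subringE(1) Span_in_carrier[OF subfieldE(3)[OF E] vs_carr] by auto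
  have "e = \<zero>"
  proof (rule ccontr)
    assume "e \<noteq> \<zero>"
    have "e \<otimes> v = \<ominus> w"
      using eq carr v(1) by (simp add: minus_equality)
    then have "e \<otimes> v \<in> Span E vs"
      using w E vs_carr by simp
    then have "v \<in> Span E vs"
      using Span_m_inv_simprule[OF E vs_carr] e \<open>e \<noteq> \<zero>\<close> v(1) by auto
    then show False using v(2) by simp
  qed
  then have "w = \<zero>" using eq v(1) carr by simp
  have "set (take (length us) (map f cs)) \<subseteq> {\<zero>}"
    using independent_imp_trivial_combine[OF K us(2), of "map f cs"] fg \<open>e = \<zero>\<close>
    by (auto simp: e_def)
  moreover have "set (take (length us) (map g cs)) \<subseteq> {\<zero>}"
    using Cons.IH[OF vs, of "map g cs"] fg \<open>w = \<zero>\<close> by (auto simp: w_def)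
  ultimately show ?case
    using fg v(1) by (fastforce simp: take_map dest: in_set_takeD)
qed

text \<open>
  A relation with coefficients in \<open>E'\<close> involves only the span of finitely many elements of
  \<open>E'\<close>, and a \<open>K\<close>-basis of that span stays independent over \<open>E\<close>.
\<close>

lemma (in domain) linearly_disjoint_sym:
  assumes K: "subfield K R" and E: "subfield E R" "K \<subseteq> E" and E': "subfield E' R" "K \<subseteq> E'"
    and disj: "linearly_disjoint K E' E"
  shows "linearly_disjoint K E E'"
  unfolding linearly_disjoint_def
proof (intro allI impI)
  fix us assume us: "set us \<subseteq> E" "independent K us"
  show "independent E' us"
  proof (rule trivial_combine_imp_independent[OF E'(1)])
    show "set us \<subseteq> carrier R" using us(2) independent_in_carrier by blast
    fix cs assume cs: "set cs \<subseteq> E'" "combine cs us = \<zero>"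
    have cs_carr: "set cs \<subseteq> carrier R" using cs(1) subfieldE(3)[OF E'(1)] by auto
    obtain vs where vs: "set vs \<subseteq> carrier R" "independent K vs" "Span K vs = Span K cs"
      using filter_base[OF K cs_carr] by blast
    have "Span K cs \<subseteq> E'"
    proof
      fix x assume "x \<in> Span K cs"
      then obtain ks where "set ks \<subseteq> K" "x = combine ks cs"
        using Span_eq_combine_set[OF K cs_carr] by auto
      then show "x \<in> E'" using combine_mem[OF subfieldE(1)[OF E'(1)]] cs(1) E'(2) by auto
    qed
    then have "independent E vs"
      using disj vs Span_base_incl[OF K vs(1)] by (auto simp: linearly_disjoint_def)
    then show "set (take (length us) cs) \<subseteq> {\<zero>}"
      using independent_imp_trivial_combine_sym[OF K E us] cs(2) vs(3) Span_base_incl[OF K cs_carr]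
      by auto
  qed
qed

lemma (in ring) Span_subset_additive:
  assumes "\<zero> \<in> V" and "\<And>x y. x \<in> V \<Longrightarrow> y \<in> V \<Longrightarrow> x \<oplus> y \<in> V"
    and "\<And>k u. k \<in> K \<Longrightarrow> u \<in> set us \<Longrightarrow> k \<otimes> u \<in> V"
  shows "Span K us \<subseteq> V"
  using assms(3)
proof (induction us)
  case (Cons u us)
  then have IH: "Span K us \<subseteq> V" by auto
  show ?case
  proof
    fix x assume "x \<in> Span K (u # us)"
    then obtain k v where "k \<in> K" "v \<in> Span K us" "x = k \<otimes> u \<oplus> v"
      unfolding Span_Cons_mem_iff by blast
    then show "x \<in> V" using IH Cons.prems assms(2) by auto
  qed
qed (use assms in auto)

lemma (in cring) Span_mult_mem:
  assumes K: "subfield K R" and us: "set us \<subseteq> carrier R" and vs: "set vs \<subseteq> carrier R"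
    and ws: "set ws \<subseteq> carrier R"
    and uv: "\<And>u v. u \<in> set us \<Longrightarrow> v \<in> set vs \<Longrightarrow> u \<otimes> v \<in> Span K ws"
    and x: "x \<in> Span K us" and y: "y \<in> Span K vs"
  shows "x \<otimes> y \<in> Span K ws"
proof -
  note K_carr = subfieldE(3)[OF K]
  have 1: "u \<otimes> y \<in> Span K ws" if u: "u \<in> set us" "y \<in> Span K vs" for u y
  proof -
    have "Span K vs \<subseteq> {y \<in> carrier R. u \<otimes> y \<in> Span K ws}"
    proof (rule Span_subset_additive)
      fix k v assume kv: "k \<in> K" "v \<in> set vs"
      then have "u \<otimes> (k \<otimes> v) = k \<otimes> (u \<otimes> v)"
        using u us vs K_carr by (intro m_lcomm) auto
      then show "k \<otimes> v \<in> {y \<in> carrier R. u \<otimes> y \<in> Span K ws}"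
        using uv[OF u(1) kv(2)] kv K ws m_closed[of k v] subsetD[OF K_carr] subsetD[OF vs] by simp
    qed (use K ws u us in \<open>auto simp: r_distr subset_iff\<close>)
    then show ?thesis using u by auto
  qed
  have y_carr: "y \<in> carrier R" using y Span_in_carrier[OF K_carr vs] by auto
  have "Span K us \<subseteq> {x \<in> carrier R. x \<otimes> y \<in> Span K ws}"
  proof (rule Span_subset_additive)
    fix k u assume ku: "k \<in> K" "u \<in> set us"
    then have "(k \<otimes> u) \<otimes> y = k \<otimes> (u \<otimes> y)"
      using us y_carr K_carr by (intro m_assoc) auto
    then show "k \<otimes> u \<in> {x \<in> carrier R. x \<otimes> y \<in> Span K ws}"
      using 1[OF ku(2) y] ku K ws m_closed[of k u] subsetD[OF K_carr] subsetD[OF us] by simp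
  qed (use K ws y_carr in \<open>auto simp: l_distr\<close>)
  then show ?thesis using x by auto
qed

section \<open>Frobenius and finite extensions\<close>

declare (in ring) finite_extension.simps [simp del]

lemma (in ring) finite_extension_Nil [simp]: "finite_extension K [] = K"
  by (simp add: finite_extension.simps)

lemma (in ring) finite_extension_Cons:
  "finite_extension K (x # xs) = simple_extension (finite_extension K xs) x"
  by (simp add: finite_extension.simps)

lemma (in domain) frob_ring_hom_ring: "ring_hom_ring R R frob"
  using ring_hom_ringI2[OF ring_axioms ring_axioms frob_ring_hom] .

lemma (in domain) frob_nat_pow:
  "x \<in> carrier R \<Longrightarrow> frob (x [^] (n::nat)) = frob x [^] n"
  by (simp add: frob_def nat_pow_pow mult.commute)

lemma (in ring) eval_mem_subring:
  assumes "subring E R" and "set p \<subseteq> E" and "x \<in> E" shows "eval p x \<in> E"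
proof -
  have pow: "x [^] (n::nat) \<in> E" for n
    using assms by (induction n) (simp_all add: subringE(3,6))
  show ?thesis
    using assms(2) by (induction p) (simp_all add: pow subringE(2,6,7)[OF assms(1)])
qed

lemma (in ring) univ_poly_coeffs: "p \<in> carrier (K[X]) \<Longrightarrow> set p \<subseteq> K"
  using polynomial_incl univ_poly_carrier by blast

text \<open>
  The hypothesis \<open>gen\<close> says that \<open>E = K[xs]\<close> is generated over \<open>K\<close> by the \<open>p\<close>-th powers of the
  generators. Extend \<open>us\<close> to a basis \<open>ws\<close> of \<open>E\<close>. The span \<open>W\<close> of the \<open>p\<close>-th powers of \<open>ws\<close>
  contains the \<open>p\<close>-th power of every element of \<open>E\<close>, so it is closed under products and contains
  \<open>E\<close>. As many vectors as the dimension of \<open>E\<close> can only span such a \<open>W\<close> if they are independent.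
\<close>

lemma (in domain) frob_preserves_independent:
  assumes K: "subfield K R" and xs: "set xs \<subseteq> carrier R"
    and alg: "\<And>x. x \<in> set xs \<Longrightarrow> (algebraic over K) x"
    and gen: "set xs \<subseteq> finite_extension K (map frob xs)"
    and us: "set us \<subseteq> finite_extension K xs" "independent K us"
  shows "independent K (map frob us)"
proof -
  interpret frob: ring_hom_ring R R frob by (rule frob_ring_hom_ring)
  note K_ring = subfieldE(1)[OF K] and K_carr = subfieldE(3)[OF K]
  define E where "E = finite_extension K xs"
  have E: "subring E R" using finite_extension_is_subring[OF K_ring xs] by (simp add: E_def)
  have E_carr: "E \<subseteq> carrier R" using subringE(1)[OF E] .
  have K_E: "K \<subseteq> E" using finite_extension_incl[OF K_carr xs] by (simp add: E_def)
  obtain n where n: "dimension n K E"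
    using finite_extension_finite_dimension(1)[OF K xs alg] by (auto simp: E_def)
  obtain vs where vs: "length (vs @ us) = n" "independent K (vs @ us)" "Span K (vs @ us) = E"
    using complete_base[OF K n us(2)] us(1) by (auto simp: E_def)
  define ws where "ws = vs @ us"
  have ws_carr: "set ws \<subseteq> carrier R"
    using vs(2) independent_in_carrier unfolding ws_def by blast
  have ws_E: "set ws \<subseteq> E" using Span_base_incl[OF K ws_carr] vs(3) by (simp add: ws_def)
  have E_eq: "E = {combine ks ws |ks. set ks \<subseteq> K}"
    using Span_eq_combine_set[OF K ws_carr] vs(3) by (simp add: ws_def)
  define fw where "fw = map frob ws"
  have fw_carr: "set fw \<subseteq> carrier R" using ws_carr by (auto simp: fw_def)
  define W where "W = Span K fw"
  \<comment> \<open>The coefficients \<open>k\<close> of \<open>z\<close> become \<open>k^p\<close>, which are again in \<open>K\<close>.\<close>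
  have frob_E: "frob z \<in> W" if z: "z \<in> E" for z
  proof -
    obtain ks where ks: "set ks \<subseteq> K" "z = combine ks ws"
      using z E_eq by auto
    have "frob z = combine (map frob ks) fw"
      unfolding ks(2) fw_def using ks(1) K_carr ws_carr by (intro frob.combine_hom[symmetric]) auto
    moreover have "set (map frob ks) \<subseteq> K" using ks(1) frob_mem_subring[OF K_ring] by auto
    ultimately show ?thesis
      using Span_eq_combine_set[OF K fw_carr] unfolding W_def by (auto intro!: exI[of _ "map frob ks"])
  qed
  have "frob \<one> = \<one>" by (rule frob.hom_one)
  then have one: "\<one> \<in> W" using frob_E[of \<one>] subringE(3)[OF E] by simp
  have W: "subring W R"
  proof (rule subringI)
    show "W \<subseteq> carrier R" unfolding W_def using K fw_carr by simp
    show "\<one> \<in> W" by (rule one)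
    fix x y assume xy: "x \<in> W" "y \<in> W"
    show "\<ominus> x \<in> W" "x \<oplus> y \<in> W"
      using xy K fw_carr unfolding W_def by simp_all
    have "u \<otimes> v \<in> Span K fw" if uv: "u \<in> set fw" "v \<in> set fw" for u v
    proof -
      obtain a b where ab: "a \<in> set ws" "b \<in> set ws" "u = frob a" "v = frob b"
        using uv by (auto simp: fw_def)
      then have "u \<otimes> v = frob (a \<otimes> b)" using subsetD[OF ws_carr] by simp
      then show ?thesis
        using frob_E[of "a \<otimes> b"] ab ws_E subringE(6)[OF E] by (auto simp: W_def)
    qed
    then show "x \<otimes> y \<in> W"
      using Span_mult_mem[OF K fw_carr fw_carr fw_carr] xy unfolding W_def by blast
  qed
  have "K \<subseteq> W"
  proof
    fix k assume k: "k \<in> K"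
    then have "k \<otimes> \<one> \<in> W" using one K fw_carr unfolding W_def by simp
    then show "k \<in> W" using k K_carr by auto
  qed
  moreover have xs_E: "set xs \<subseteq> E"
    using finite_extension_mem[OF K_ring xs] by (simp add: E_def)
  ultimately have "finite_extension K (map frob xs) \<subseteq> W"
    using frob_E by (intro finite_extension_subring_incl W) auto
  then have "E \<subseteq> W"
    unfolding E_def using gen \<open>K \<subseteq> W\<close> by (intro finite_extension_subring_incl W) auto
  have "independent K fw"
  proof (rule ccontr)
    assume "dependent K fw"
    then obtain m where "m < length fw" "dimension m K W"
      using dependent_imp_Span_dimension_less[OF K fw_carr] by (auto simp: W_def)
    moreover have "length ws \<le> m"
      using independent_length_le_dimension[OF K \<open>dimension m K W\<close> vs(2)[folded ws_def]]
        ws_E \<open>E \<subseteq> W\<close> by blast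
    ultimately show False by (simp add: fw_def)
  qed
  then show ?thesis
    using independent_split(1)[OF K] by (simp add: fw_def ws_def)
qed

text \<open>
  Equivalent to separability, see \<open>separable_algebraic_iff_frob_sep\<close> below, but stated without
  polynomials: \<open>K[x] = K[x^p]\<close>. In characteristic zero it is just algebraicity.
\<close>

definition (in ring) frob_sep :: "'a set \<Rightarrow> 'a \<Rightarrow> bool"
  where "frob_sep K x \<longleftrightarrow> (algebraic over K) x \<and> x \<in> simple_extension K (frob x)"

lemma (in domain) simple_extension_frob_subset:
  assumes K: "subring K R" and x: "x \<in> carrier R"
  shows "simple_extension K (frob x) \<subseteq> simple_extension K x"
  using simple_extension_is_subring[OF assms] simple_extension_mem[OF assms]
    simple_extension_incl[OF subringE(1)[OF K] x] frob_mem_subring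
  by (intro simple_extension_subring_incl) auto

text \<open>
  Used to see that a chain of simple extensions has become stationary: \<open>K[y]\<close> already contains
  as many independent elements as the degree of \<open>x\<close>.
\<close>

lemma (in domain) simple_extension_eqI:
  assumes K: "subfield K R" and x: "x \<in> carrier R" "(algebraic over K) x"
    and y: "y \<in> simple_extension K x" and us: "set us \<subseteq> simple_extension K y"
    and ind: "independent K us" and len: "degree (Irr K x) \<le> length us"
  shows "simple_extension K y = simple_extension K x"
proof
  note K_ring = subfieldE(1)[OF K] and K_carr = subfieldE(3)[OF K]
  have y_carr: "y \<in> carrier R"
    using y simple_extension_in_carrier[OF K_carr x(1)] by auto
  show sub: "simple_extension K y \<subseteq> simple_extension K x"
    using simple_extension_is_subring[OF K_ring x(1)] simple_extension_incl[OF K_carr x(1)] y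
    by (intro simple_extension_subring_incl) auto
  have dim: "dimension (degree (Irr K x)) K (simple_extension K x)"
    by (rule dimension_simple_extension[OF K x])
  have us_x: "set us \<subseteq> simple_extension K x" using us sub by auto
  have "Span K us = simple_extension K x"
    using independent_length_eq_dimension[OF K dim ind us_x]
      independent_length_le_dimension[OF K dim ind us_x] len by auto
  moreover have "Span K us \<subseteq> simple_extension K y"
  proof -
    have alg: "(algebraic over K) y"
      by (rule simple_extesion_mem_imp_algebraic[OF K x y])
    have "subalgebra K (simple_extension K y) R"
      using finite_dimension_imp_subalgebra[OF K] finite_dimension_simple_extension[OF K y_carr] alg
      by simp
    then show ?thesis using subalgebra_Span_incl[OF K _ us] by blast
  qed
  ultimately show "simple_extension K x \<subseteq> simple_extension K y" by simp
qed

text \<open>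
  The powers of \<open>z\<close> that form a basis of \<open>K[z]\<close> are mapped by Frobenius to independent elements
  of \<open>K[z^p]\<close>, so the two fields have the same dimension.
\<close>

lemma (in domain) frob_sep_of_mem_finite_extension:
  assumes K: "subfield K R" and xs: "set xs \<subseteq> carrier R"
    and alg: "\<And>x. x \<in> set xs \<Longrightarrow> (algebraic over K) x"
    and gen: "set xs \<subseteq> finite_extension K (map frob xs)"
    and z: "z \<in> finite_extension K xs"
  shows "frob_sep K z"
proof -
  note K_ring = subfieldE(1)[OF K] and K_carr = subfieldE(3)[OF K]
  have z_carr: "z \<in> carrier R" using z finite_extension_in_carrier[OF K_carr xs] by auto
  have alg_z: "(algebraic over K) z"
    by (rule finite_extesion_mem_imp_algebraic[OF K xs alg z])
  define m where "m = degree (Irr K z)"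
  define us where "us = exp_base z m"
  have "independent K us"
    unfolding us_def m_def by (rule exp_base_independent[OF K z_carr alg_z])
  moreover have pow: "z [^] (n::nat) \<in> finite_extension K xs" for n
    using finite_extension_is_subring[OF K_ring xs] z
    by (induction n) (auto simp: subringE(3,6))
  then have "set us \<subseteq> finite_extension K xs" by (auto simp: us_def exp_base_def)
  ultimately have ind: "independent K (map frob us)"
    using frob_preserves_independent[OF K xs alg gen] by blast
  note sub = simple_extension_is_subring[OF K_ring, of "frob z"]
  have fpow: "frob z [^] (n::nat) \<in> simple_extension K (frob z)" for n
    using sub z_carr simple_extension_mem[OF K_ring, of "frob z"]
    by (induction n) (auto simp: subringE(3,6))
  have "set (map frob us) \<subseteq> simple_extension K (frob z)"
    using fpow z_carr by (auto simp: us_def exp_base_def frob_nat_pow)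
  then have "simple_extension K (frob z) = simple_extension K z"
    using simple_extension_frob_subset[OF K_ring z_carr] simple_extension_mem[OF K_ring, of "frob z"] z_carr
    by (intro simple_extension_eqI[OF K z_carr alg_z _ _ ind]) (auto simp: us_def m_def exp_base_def)
  then show ?thesis
    using simple_extension_mem[OF K_ring z_carr] alg_z by (simp add: frob_sep_def)
qed

lemma (in domain) frob_sep_generators:
  assumes K: "subfield K R" and xs: "set xs \<subseteq> carrier R"
    and sep: "\<And>x. x \<in> set xs \<Longrightarrow> frob_sep K x"
  shows "set xs \<subseteq> finite_extension K (map frob xs)"
proof
  note K_ring = subfieldE(1)[OF K] and K_carr = subfieldE(3)[OF K]
  have carr: "set (map frob xs) \<subseteq> carrier R" using xs by auto
  fix x assume x: "x \<in> set xs"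
  have "simple_extension K (frob x) \<subseteq> finite_extension K (map frob xs)"
    using x finite_extension_mem[OF K_ring carr] finite_extension_incl[OF K_carr carr]
    by (intro simple_extension_subring_incl finite_extension_is_subring[OF K_ring carr]) auto
  then show "x \<in> finite_extension K (map frob xs)"
    using sep[OF x] by (auto simp: frob_sep_def)
qed

lemma (in domain) frob_sep_finite_extension:
  assumes K: "subfield K R" and xs: "set xs \<subseteq> carrier R"
    and sep: "\<And>x. x \<in> set xs \<Longrightarrow> frob_sep K x" and z: "z \<in> finite_extension K xs"
  shows "frob_sep K z"
  using frob_sep_of_mem_finite_extension[OF K xs _ frob_sep_generators[OF K xs sep] z] sep
  by (auto simp: frob_sep_def)

lemma (in domain) frob_preserves_independent_of_sep:
  assumes K: "subfield K R" and us: "independent K us"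
    and sep: "\<And>x. x \<in> set us \<Longrightarrow> frob_sep K x"
  shows "independent K (map frob us)"
proof -
  have carr: "set us \<subseteq> carrier R" using us independent_in_carrier by blast
  show ?thesis
    using sep by (intro frob_preserves_independent[OF K carr _ frob_sep_generators[OF K carr sep] _ us]
      finite_extension_mem[OF subfieldE(1)[OF K] carr]) (auto simp: frob_sep_def)
qed

lemma (in field) subfield_of_frob_sep:
  assumes K: "subfield K R" shows "subfield {x \<in> carrier R. frob_sep K x} R"
proof -
  note K_ring = subfieldE(1)[OF K] and K_carr = subfieldE(3)[OF K]
  show ?thesis
  proof (rule subfieldI'[OF subringI])
    show "{x \<in> carrier R. frob_sep K x} \<subseteq> carrier R" by auto
    show "\<one> \<in> {x \<in> carrier R. frob_sep K x}"
      using frob_sep_finite_extension[OF K, of "[]" \<one>] subringE(3)[OF K_ring] by auto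
  next
    fix x y assume x: "x \<in> {x \<in> carrier R. frob_sep K x}" and y: "y \<in> {x \<in> carrier R. frob_sep K x}"
    have carr: "set [x, y] \<subseteq> carrier R" using x y by auto
    note ring = finite_extension_is_subring[OF K_ring carr]
      and mem = finite_extension_mem[OF K_ring carr]
    have "frob_sep K z" if "z \<in> finite_extension K [x, y]" for z
      using frob_sep_finite_extension[OF K carr _ that] x y by auto
    then show "\<ominus> x \<in> {x \<in> carrier R. frob_sep K x}"
      "x \<otimes> y \<in> {x \<in> carrier R. frob_sep K x}" "x \<oplus> y \<in> {x \<in> carrier R. frob_sep K x}"
      using subringE(5)[OF ring, of x] subringE(6,7)[OF ring, of x y] mem x y by auto
  next
    fix x assume x: "x \<in> {x \<in> carrier R. frob_sep K x} - {\<zero>}"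
    have carr: "set [x] \<subseteq> carrier R" using x by auto
    have field: "subfield (finite_extension K [x]) R"
      using x by (intro finite_extension_is_subfield[OF K carr]) (auto simp: frob_sep_def)
    have "inv x \<in> finite_extension K [x]"
      using subfield_m_inv(1)[OF field, of x] finite_extension_mem[OF K_ring carr] x by auto
    then have "frob_sep K (inv x)"
      using frob_sep_finite_extension[OF K carr] x by auto
    then show "inv x \<in> {x \<in> carrier R. frob_sep K x}"
      using x field_Units by auto
  qed
qed

lemma (in ring) frob_sep_mono:
  assumes "K \<subseteq> M" "frob_sep K x" shows "frob_sep M x"
  using algebraic_mono[OF assms(1)] mono_simple_extension[OF assms(1)] assms(2)
  by (auto simp: frob_sep_def)

lemma (in domain) frob_sep_self:
  assumes "subfield K R" "x \<in> K" shows "frob_sep K x"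
  using frob_sep_finite_extension[OF assms(1), of "[]" x] assms(2) by simp

text \<open>
  Only the coefficients of the minimal polynomial of \<open>a\<close> matter, and they generate a finite
  extension of \<open>K\<close>.
\<close>

lemma (in domain) algebraic_trans:
  assumes K: "subfield K R" and M: "subfield M R" "\<And>x. x \<in> M \<Longrightarrow> (algebraic over K) x"
    and a: "a \<in> carrier R" "(algebraic over M) a"
  shows "(algebraic over K) a"
proof -
  note K_ring = subfieldE(1)[OF K]
  define h where "h = Irr M a"
  note h = IrrE[OF M(1) a, folded h_def]
  have h_M: "set h \<subseteq> M" using univ_poly_coeffs[OF h(1)] .
  have h_carr: "set h \<subseteq> carrier R" using h_M subfieldE(3)[OF M(1)] by auto
  define N where "N = finite_extension K h"
  have alg: "(algebraic over K) x" if "x \<in> set h" for x using h_M M(2) that by auto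
  have N: "subfield N R" "finite_dimension K N"
    unfolding N_def using finite_extension_is_subfield[OF K h_carr alg]
      finite_extension_finite_dimension(1)[OF K h_carr alg] by auto
  have "h \<in> carrier (N[X])"
    using h(1) finite_extension_mem[OF K_ring h_carr]
    unfolding univ_poly_carrier[symmetric] polynomial_def N_def by auto
  moreover have "h \<noteq> []"
    using pirreducibleE(1)[OF subfieldE(1)[OF M(1)] h(1,2)] .
  ultimately have "(algebraic over N) a" using algebraicI h(4) by blast
  then have "finite_dimension N (simple_extension N a)"
    using finite_dimension_simple_extension[OF N(1) a(1)] by simp
  then have "finite_dimension K (simple_extension N a)"
    using telescopic_base_dim(1)[OF K N(1) N(2)] by blast
  then show ?thesis
    using finite_dimension_imp_algebraic[OF K simple_extension_is_subring]
      simple_extension_mem subfieldE(1)[OF N(1)] a(1) by blast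
qed

text \<open>
  Write \<open>a = g(a^p)\<close> with \<open>g\<close> over \<open>M\<close>. The list that consists of \<open>a\<close> and the coefficients of
  \<open>g\<close> is contained in the field generated by its own \<open>p\<close>-th powers.
\<close>

lemma (in domain) frob_sep_trans:
  assumes K: "subfield K R" and M: "subfield M R" "K \<subseteq> M" "\<And>x. x \<in> M \<Longrightarrow> frob_sep K x"
    and a: "a \<in> carrier R" "frob_sep M a"
  shows "frob_sep K a"
proof -
  note K_ring = subfieldE(1)[OF K] and M_carr = subfieldE(3)[OF M(1)]
  have alg: "(algebraic over K) a"
    by (rule algebraic_trans[OF K M(1) _ a(1)]) (use a M(3) in \<open>auto simp: frob_sep_def\<close>)
  obtain g where g: "g \<in> carrier (M[X])" "eval g (frob a) = a"
    using a simple_extension_as_eval_img[OF M_carr, of "frob a"] unfolding frob_sep_def by auto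
  have g_M: "set g \<subseteq> M" using univ_poly_coeffs[OF g(1)] .
  have carr: "set (a # g) \<subseteq> carrier R" "set (map frob (a # g)) \<subseteq> carrier R"
    using g_M M_carr a(1) by auto
  define E where "E = finite_extension K (map frob (a # g))"
  have E: "subring E R" unfolding E_def by (rule finite_extension_is_subring[OF K_ring carr(2)])
  have mem: "set (map frob (a # g)) \<subseteq> E"
    unfolding E_def by (rule finite_extension_mem[OF K_ring carr(2)])
  have KE: "K \<subseteq> E"
    unfolding E_def by (rule finite_extension_incl[OF subfieldE(3)[OF K] carr(2)])
  have "set g \<subseteq> E"
  proof
    fix c assume c: "c \<in> set g"
    then have "c \<in> simple_extension K (frob c)" using g_M M(3) by (auto simp: frob_sep_def)
    moreover have "simple_extension K (frob c) \<subseteq> E"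
      using c mem by (intro simple_extension_subring_incl[OF E KE]) auto
    ultimately show "c \<in> E" by auto
  qed
  then have "a \<in> E"
    using eval_mem_subring[OF E, of g "frob a"] mem g(2) by auto
  then have "set (a # g) \<subseteq> finite_extension K (map frob (a # g))"
    using \<open>set g \<subseteq> E\<close> unfolding E_def by auto
  moreover have "a \<in> finite_extension K (a # g)"
    using finite_extension_mem[OF K_ring carr(1)] by auto
  moreover have "(algebraic over K) x" if "x \<in> set (a # g)" for x
    using that alg g_M M(3) by (auto simp: frob_sep_def)
  ultimately show ?thesis
    using frob_sep_of_mem_finite_extension[OF K carr(1)] by blast
qed

text \<open>
  Choose an iterate of minimal degree over \<open>K\<close>; applying Frobenius once more then gives the same
  field.
\<close>

lemma (in domain) algebraic_imp_frob_funpow_sep: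
  assumes K: "subfield K R" and x: "x \<in> carrier R" "(algebraic over K) x"
  obtains n where "frob_sep K ((frob ^^ n) x)"
proof -
  note K_ring = subfieldE(1)[OF K]
  define d where "d = (\<lambda>n. degree (Irr K ((frob ^^ n) x)))"
  obtain n where n: "\<And>m. d n \<le> d m"
    using ex_has_least_nat[of "\<lambda>_. True" _ d] by blast
  define y where "y = (frob ^^ n) x"
  have y: "y \<in> carrier R" using x by (simp add: y_def)
  have "y \<in> simple_extension K x"
    unfolding y_def using simple_extension_mem[OF K_ring x(1)]
    by (intro frob_funpow_mem_subring simple_extension_is_subring[OF K_ring x(1)])
  then have y_alg: "(algebraic over K) y" by (rule simple_extesion_mem_imp_algebraic[OF K x])
  have fy: "frob y \<in> simple_extension K y"
    by (intro frob_mem_subring simple_extension_is_subring[OF K_ring y] simple_extension_mem[OF K_ring y])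
  then have fy_alg: "(algebraic over K) (frob y)" by (rule simple_extesion_mem_imp_algebraic[OF K y y_alg])
  note fy_carr = frob_closed[OF y]
  define us where "us = exp_base (frob y) (degree (Irr K (frob y)))"
  have "degree (Irr K y) \<le> length us"
    using n[of "Suc n"] by (simp add: us_def exp_base_def d_def y_def)
  moreover have "independent K us"
    unfolding us_def by (rule exp_base_independent[OF K fy_carr fy_alg])
  moreover have "set us \<subseteq> simple_extension K (frob y)"
    using Span_exp_base[OF K fy_carr fy_alg] Span_base_incl[OF K exp_base_closed[OF fy_carr]]
    unfolding us_def by blast
  ultimately have "simple_extension K (frob y) = simple_extension K y"
    using simple_extension_eqI[OF K y y_alg fy] by blast
  then have "frob_sep K y"
    using y_alg simple_extension_mem[OF K_ring y] by (simp add: frob_sep_def)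
  then show thesis using that y_def by blast
qed

lemma (in field) frob_sep_funpow:
  assumes K: "subfield K R" and "x \<in> carrier R" "frob_sep K x"
  shows "frob_sep K ((frob ^^ n) x)"
  using frob_funpow_mem_subring[OF subfieldE(1)[OF subfield_of_frob_sep[OF K]], of x n] assms by auto

text \<open>
  An element that is both separable and purely inseparable over \<open>K\<close> lies in \<open>K\<close>.
\<close>

lemma (in field) frob_sep_funpow_mem_imp_mem:
  assumes K: "subfield K R"
  shows "x \<in> carrier R \<Longrightarrow> frob_sep K x \<Longrightarrow> (frob ^^ n) x \<in> K \<Longrightarrow> x \<in> K"
proof (induction n arbitrary: x)
  case (Suc n)
  have "frob x \<in> K"
    using Suc.IH[of "frob x"] frob_sep_funpow[OF K Suc.prems(1,2), of 1] Suc.prems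
    by (simp add: funpow_swap1)
  then have "simple_extension K (frob x) \<subseteq> K"
    by (intro simple_extension_subring_incl subfieldE(1)[OF K]) auto
  then show ?case using Suc.prems(2) by (auto simp: frob_sep_def)
qed auto

section \<open>Separability and simple roots\<close>

text \<open>
  Polynomials are lists of coefficients with the leading one first. The list is not normalised:
  multiples of the characteristic produce leading zeros, and the length always drops by one.
\<close>

fun (in ring) formal_deriv :: "'a list \<Rightarrow> 'a list"
  where
    "formal_deriv (c # d # cs) = ([length (d # cs)] \<cdot> c) # formal_deriv (d # cs)"
  | "formal_deriv cs = []"

lemma (in ring) length_formal_deriv: "length (formal_deriv p) = length p - 1"
  by (induction p rule: formal_deriv.induct) auto

lemma (in ring) formal_deriv_mem_subring:
  assumes "subring E R" and "set p \<subseteq> E" shows "set (formal_deriv p) \<subseteq> E"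
proof -
  have "[(n::nat)] \<cdot> c \<in> E" if "c \<in> E" for c n
    using that subringE(2,7)[OF assms(1)] by (induction n) simp_all
  then show ?thesis
    using assms(2) subringE(7)[OF assms(1)] by (induction p rule: formal_deriv.induct) auto
qed

lemma (in cring) eval_formal_deriv_Cons:
  assumes "c \<in> carrier R" "set cs \<subseteq> carrier R" "v \<in> carrier R"
  shows "eval (formal_deriv (c # cs)) v
    = [length cs] \<cdot> c \<otimes> v [^] (length cs - 1) \<oplus> eval (formal_deriv cs) v"
  using assms by (cases cs) (simp_all add: length_formal_deriv)

lemma (in cring) power_Taylor:
  assumes v: "v \<in> carrier R" and h: "h \<in> carrier R"
  shows "\<exists>r\<in>carrier R. (v \<oplus> h) [^] (n::nat) = v [^] n \<oplus> h \<otimes> [n] \<cdot> (v [^] (n - 1)) \<oplus> h \<otimes> h \<otimes> r"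
proof (induction n)
  case 0
  then show ?case using assms by (intro bexI[of _ \<zero>]) auto
next
  case (Suc n)
  then obtain r where r: "r \<in> carrier R"
    "(v \<oplus> h) [^] n = v [^] n \<oplus> h \<otimes> [n] \<cdot> (v [^] (n - 1)) \<oplus> h \<otimes> h \<otimes> r" by auto
  define a b where "a = [n] \<cdot> (v [^] (n - 1))" and "b = v [^] n"
  have ab: "a \<in> carrier R" "b \<in> carrier R" using v by (auto simp: a_def b_def)
  have av: "a \<otimes> v = [n] \<cdot> b"
    using v by (cases n) (simp_all add: a_def b_def add_pow_ldistr l_distr)
  have nb: "[Suc n] \<cdot> b = a \<otimes> v \<oplus> b" using ab av by simp
  have "(v \<oplus> h) [^] Suc n = (b \<oplus> h \<otimes> a \<oplus> h \<otimes> h \<otimes> r) \<otimes> (v \<oplus> h)"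
    using r by (simp add: a_def b_def)
  also have "\<dots> = b \<otimes> v \<oplus> h \<otimes> (a \<otimes> v \<oplus> b) \<oplus> h \<otimes> h \<otimes> (a \<oplus> r \<otimes> v \<oplus> h \<otimes> r)"
    using ab v h r(1) by algebra
  finally have "(v \<oplus> h) [^] Suc n
      = v [^] Suc n \<oplus> h \<otimes> [Suc n] \<cdot> b \<oplus> h \<otimes> h \<otimes> (a \<oplus> r \<otimes> v \<oplus> h \<otimes> r)"
    unfolding nb nat_pow_Suc b_def[symmetric] .
  then show ?case
    using ab v h r(1) by (intro bexI[of _ "a \<oplus> r \<otimes> v \<oplus> h \<otimes> r"]) (auto simp: b_def)
qed

text \<open>
  Stated for arbitrary commutative rings since it will be applied inside a polynomial ring, at
  points such as the indeterminate \<open>X = a + (X - a)\<close>.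
\<close>

lemma (in cring) eval_Taylor:
  assumes v: "v \<in> carrier R" and h: "h \<in> carrier R" and "set p \<subseteq> carrier R"
  shows "\<exists>r\<in>carrier R. eval p (v \<oplus> h) = eval p v \<oplus> h \<otimes> eval (formal_deriv p) v \<oplus> h \<otimes> h \<otimes> r"
  using assms(3)
proof (induction p)
  case Nil
  then show ?case using assms by (intro bexI[of _ \<zero>]) auto
next
  case (Cons c cs)
  have cs: "set cs \<subseteq> carrier R" and c: "c \<in> carrier R" using Cons.prems by auto
  obtain r where r: "r \<in> carrier R"
    "eval cs (v \<oplus> h) = eval cs v \<oplus> h \<otimes> eval (formal_deriv cs) v \<oplus> h \<otimes> h \<otimes> r"
    using Cons.IH[OF cs] by auto
  define n where "n = length cs"
  obtain s where s: "s \<in> carrier R"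
    "(v \<oplus> h) [^] n = v [^] n \<oplus> h \<otimes> [n] \<cdot> (v [^] (n - 1)) \<oplus> h \<otimes> h \<otimes> s"
    using power_Taylor[OF v h] by blast
  define e d b a where "e = eval cs v" and "d = eval (formal_deriv cs) v"
    and "b = v [^] n" and "a = v [^] (n - 1)"
  have carr: "e \<in> carrier R" "d \<in> carrier R" "b \<in> carrier R" "a \<in> carrier R"
    using v cs formal_deriv_mem_subring[OF carrier_is_subring cs]
    by (auto simp: e_def d_def b_def a_def intro!: eval_in_carrier)
  have na: "c \<otimes> [n] \<cdot> a = [n] \<cdot> c \<otimes> a"
    using c carr by (simp add: add_pow_ldistr add_pow_rdistr)
  have na_carr: "[n] \<cdot> a \<in> carrier R" using carr by simp
  have "eval (c # cs) (v \<oplus> h) = c \<otimes> (b \<oplus> h \<otimes> [n] \<cdot> a \<oplus> h \<otimes> h \<otimes> s) \<oplus> (e \<oplus> h \<otimes> d \<oplus> h \<otimes> h \<otimes> r)"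
    using r s by (simp add: n_def[symmetric] e_def d_def b_def a_def)
  also have "\<dots> = (c \<otimes> b \<oplus> e) \<oplus> h \<otimes> (c \<otimes> [n] \<cdot> a \<oplus> d) \<oplus> h \<otimes> h \<otimes> (c \<otimes> s \<oplus> r)"
    using c h s(1) r(1) carr na_carr by algebra
  also have "c \<otimes> b \<oplus> e = eval (c # cs) v"
    by (simp add: n_def b_def e_def)
  also have "c \<otimes> [n] \<cdot> a \<oplus> d = eval (formal_deriv (c # cs)) v"
    unfolding na eval_formal_deriv_Cons[OF c cs v] by (simp add: n_def a_def d_def)
  finally show ?case using c s r by (intro bexI[of _ "c \<otimes> s \<oplus> r"]) auto
qed

lemma (in ring_hom_ring) formal_deriv_hom:
  "set p \<subseteq> carrier R \<Longrightarrow> S.formal_deriv (map h p) = map h (R.formal_deriv p)"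
proof (induction p rule: R.formal_deriv.induct)
  case (1 c d cs)
  have "h ([(n::nat)] \<cdot>\<^bsub>R\<^esub> c) = [n] \<cdot>\<^bsub>S\<^esub> h c" if "c \<in> carrier R" for c n
    using that by (induction n) simp_all
  then show ?case using 1 by simp
qed auto

lemma (in ring) univ_poly_carrier_restrict:
  "p \<in> carrier (E[X]) \<Longrightarrow> set p \<subseteq> K \<Longrightarrow> p \<in> carrier (K[X])"
  unfolding univ_poly_carrier[symmetric] polynomial_def by blast

lemma (in domain) univ_poly_subring:
  assumes "subring K R" shows "subring (carrier (K[X])) (poly_ring R)"
proof (rule ring.ring_incl_imp_subring)
  show "ring (poly_ring R)" by (rule univ_poly_is_ring[OF carrier_is_subring])
  show "carrier (K[X]) \<subseteq> carrier (poly_ring R)" using carrier_polynomial_shell[OF assms] by auto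
  have "(poly_ring R)\<lparr>carrier := carrier (K[X])\<rparr> = K[X]" by (simp add: univ_poly_def)
  then show "ring ((poly_ring R)\<lparr>carrier := carrier (K[X])\<rparr>)"
    using univ_poly_is_ring[OF assms] by simp
qed

lemma (in ring) poly_of_const_mem:
  assumes "c \<in> K" shows "poly_of_const c \<in> carrier (K[X])"
  using normalize_gives_polynomial[of "[c]" K] assms
  by (simp add: poly_of_const_def univ_poly_carrier)

lemma (in domain) poly_of_const_hom: "ring_hom_ring R (poly_ring R) poly_of_const"
  using canonical_embedding_ring_hom[OF carrier_is_subring] by simp

lemma (in ring) eval_poly_of_const:
  "c \<in> carrier R \<Longrightarrow> y \<in> carrier R \<Longrightarrow> eval (poly_of_const c) y = c"
  by (simp add: poly_of_const_def)

lemma (in domain) linear_factor: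
  assumes a: "a \<in> carrier R"
  shows "[\<one>, \<ominus> a] \<in> carrier (poly_ring R)" and "poly_of_const a \<oplus>\<^bsub>poly_ring R\<^esub> [\<one>, \<ominus> a] = X"
    and "eval [\<one>, \<ominus> a] a = \<zero>"
proof -
  show "[\<one>, \<ominus> a] \<in> carrier (poly_ring R)"
    using a by (auto simp: univ_poly_def polynomial_def)
  show "poly_of_const a \<oplus>\<^bsub>poly_ring R\<^esub> [\<one>, \<ominus> a] = X"
    using a by (auto simp: univ_poly_def poly_of_const_def var_def r_neg l_neg)
  show "eval [\<one>, \<ominus> a] a = \<zero>" using a by (simp add: r_neg)
qed

lemma (in domain) obtain_power_minus_const:
  assumes K: "subring K R" and c: "c \<in> K" and m: "(m::nat) > 0"
  obtains q where "q \<in> carrier (K[X])" "q \<noteq> []"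
    "\<And>z. z \<in> carrier R \<Longrightarrow> eval q z = z [^] m \<ominus> c"
proof -
  define q where "q = monom \<one> (m - 1) @ [\<ominus> c]"
  have "q \<in> carrier (K[X])"
    unfolding univ_poly_carrier[symmetric] polynomial_def q_def monom_def
    using subringE(2,3)[OF K] subringE(5)[OF K c] by (simp add: set_replicate_conv_if)
  moreover have "eval q z = z [^] m \<ominus> c" if z: "z \<in> carrier R" for z
  proof -
    have "c \<in> carrier R" using c subringE(1)[OF K] by auto
    moreover have "z [^] (m - 1) \<otimes> z = z [^] m" using m by (cases m) auto
    ultimately show ?thesis
      using z eval_append_aux[OF monom_in_carrier[OF one_closed], of "\<ominus> c" z "m - 1"]
      by (simp add: q_def eval_monom a_minus_def)
  qed
  ultimately show thesis using that by (auto simp: q_def)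
qed

text \<open>
  The composition \<open>p(f(X))\<close>, obtained by evaluating \<open>p\<close> in the ring of polynomials.
\<close>

definition (in ring) poly_compose :: "'a list \<Rightarrow> 'a list \<Rightarrow> 'a list"
  where "poly_compose p f = ring.eval (poly_ring R) (map poly_of_const p) f"

lemma (in domain) poly_compose_closed:
  assumes E: "subring E R" and p: "set p \<subseteq> E" and f: "f \<in> carrier (E[X])"
  shows "poly_compose p f \<in> carrier (E[X])"
proof -
  interpret UP: domain "poly_ring R" by (rule univ_poly_is_domain[OF carrier_is_subring])
  have "set (map poly_of_const p) \<subseteq> carrier (E[X])"
    using p poly_of_const_mem[of _ E] by auto
  then show ?thesis
    unfolding poly_compose_def by (rule UP.eval_mem_subring[OF univ_poly_subring[OF E] _ f])
qed

lemma (in domain) eval_poly_compose: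
  assumes p: "set p \<subseteq> carrier R" and f: "f \<in> carrier (poly_ring R)" and y: "y \<in> carrier R"
  shows "eval (poly_compose p f) y = eval p (eval f y)"
proof -
  interpret ev: ring_hom_ring "poly_ring R" R "\<lambda>q. eval q y"
    by (rule eval_ring_hom[OF carrier_is_subring y])
  have "map (\<lambda>q. eval q y) (map poly_of_const p) = p"
    using p y by (induction p) (auto simp: eval_poly_of_const)
  moreover have "set (map poly_of_const p) \<subseteq> carrier (poly_ring R)"
    using p poly_of_const_mem[of _ "carrier R"] by auto
  ultimately show ?thesis
    unfolding poly_compose_def using ev.eval_hom'[OF f, of "map poly_of_const p"] by simp
qed

lemma (in domain) Irr_eqI:
  assumes K: "subfield K R" and y: "y \<in> carrier R"
    and p: "p \<in> carrier (K[X])" "pirreducible K p" "eval p y = \<zero>" "lead_coeff p = \<one>"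
  shows "(algebraic over K) y" and "Irr K y = p"
proof -
  have "p \<noteq> []" using pirreducibleE(1)[OF subfieldE(1)[OF K] p(1,2)] .
  then show alg: "(algebraic over K) y" using algebraicI p by blast
  show "Irr K y = p"
    using minimal_polynomial_is_unique[OF K y alg] IrrE[OF K y alg] p by blast
qed

lemma (in domain) Irr_root:
  assumes K: "subfield K R" and x: "x \<in> carrier R" "(algebraic over K) x"
    and y: "y \<in> carrier R" "eval (Irr K x) y = \<zero>"
  shows "(algebraic over K) y" and "Irr K y = Irr K x"
  using Irr_eqI[OF K y(1) IrrE(1,2)[OF K x] y(2) IrrE(3)[OF K x]] by auto

text \<open>
  Compare \<open>f = (X - a)\<^sup>2 s\<close> with the Taylor expansion of \<open>f\<close> at \<open>a\<close> modulo \<open>(X - a)\<^sup>2\<close>, cancel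
  \<open>X - a\<close> and evaluate at \<open>a\<close>.
\<close>

lemma (in field) double_root_imp_deriv_root:
  assumes f: "f \<in> carrier (poly_ring R)" and a: "a \<in> carrier R"
    and double: "[\<one>, \<ominus> a] [^]\<^bsub>poly_ring R\<^esub> (2::nat) pdivides f"
  shows "eval (formal_deriv f) a = \<zero>"
proof -
  interpret UP: domain "poly_ring R" by (rule univ_poly_is_domain[OF carrier_is_subring])
  interpret C: ring_hom_ring R "poly_ring R" poly_of_const by (rule poly_of_const_hom)
  interpret ev: ring_hom_ring "poly_ring R" R "\<lambda>p. eval p a"
    by (rule eval_ring_hom[OF carrier_is_subring a])
  let ?P = "poly_ring R"
  define Q where "Q = [\<one>, \<ominus> a]"
  note Q = linear_factor[OF a, folded Q_def]
  have Q0: "Q \<noteq> \<zero>\<^bsub>?P\<^esub>" by (simp add: Q_def univ_poly_zero)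
  have f_carr: "set f \<subseteq> carrier R" using univ_poly_coeffs[OF f] .
  have Cf: "set (map poly_of_const f) \<subseteq> carrier ?P" using f_carr by auto
  have Df_carr: "set (formal_deriv f) \<subseteq> carrier R"
    by (rule formal_deriv_mem_subring[OF carrier_is_subring f_carr])
  define d where "d = eval (formal_deriv f) a"
  have d: "d \<in> carrier R" unfolding d_def using Df_carr a by (rule eval_in_carrier)
  obtain s where s: "s \<in> carrier ?P" "f = (Q [^]\<^bsub>?P\<^esub> (2::nat)) \<otimes>\<^bsub>?P\<^esub> s"
    using double by (auto simp: pdivides_def factor_def Q_def)
  have Q_square: "Q [^]\<^bsub>?P\<^esub> (2::nat) = Q \<otimes>\<^bsub>?P\<^esub> Q"
    using Q(1) by (simp add: numeral_2_eq_2)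
  have f_root: "eval f a = \<zero>"
    using Q(1,3) s(1) unfolding s(2) Q_square by simp
  obtain r where r: "r \<in> carrier ?P"
    "UP.eval (map poly_of_const f) (poly_of_const a \<oplus>\<^bsub>?P\<^esub> Q)
      = UP.eval (map poly_of_const f) (poly_of_const a)
        \<oplus>\<^bsub>?P\<^esub> Q \<otimes>\<^bsub>?P\<^esub> UP.eval (UP.formal_deriv (map poly_of_const f)) (poly_of_const a)
        \<oplus>\<^bsub>?P\<^esub> Q \<otimes>\<^bsub>?P\<^esub> Q \<otimes>\<^bsub>?P\<^esub> r"
    using UP.eval_Taylor[OF _ Q(1) Cf, of "poly_of_const a"] a by auto
  have "f = UP.eval (map poly_of_const f) (poly_of_const a \<oplus>\<^bsub>?P\<^esub> Q)"
    unfolding Q(2) by (rule eval_rewrite[OF carrier_is_subring f])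
  also have "\<dots> = poly_of_const \<zero> \<oplus>\<^bsub>?P\<^esub> Q \<otimes>\<^bsub>?P\<^esub> poly_of_const d \<oplus>\<^bsub>?P\<^esub> Q \<otimes>\<^bsub>?P\<^esub> Q \<otimes>\<^bsub>?P\<^esub> r"
    unfolding r(2) C.formal_deriv_hom[OF f_carr] C.eval_hom'[OF a f_carr, symmetric]
      C.eval_hom'[OF a Df_carr, symmetric] f_root d_def ..
  also have "\<dots> = Q \<otimes>\<^bsub>?P\<^esub> poly_of_const d \<oplus>\<^bsub>?P\<^esub> Q \<otimes>\<^bsub>?P\<^esub> Q \<otimes>\<^bsub>?P\<^esub> r"
    using Q(1) d r(1) by simp
  finally have "Q \<otimes>\<^bsub>?P\<^esub> poly_of_const d \<oplus>\<^bsub>?P\<^esub> Q \<otimes>\<^bsub>?P\<^esub> Q \<otimes>\<^bsub>?P\<^esub> r = Q \<otimes>\<^bsub>?P\<^esub> Q \<otimes>\<^bsub>?P\<^esub> s"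
    unfolding s(2) Q_square by (rule sym)
  moreover have "Q \<otimes>\<^bsub>?P\<^esub> poly_of_const d \<oplus>\<^bsub>?P\<^esub> Q \<otimes>\<^bsub>?P\<^esub> Q \<otimes>\<^bsub>?P\<^esub> r
      = Q \<otimes>\<^bsub>?P\<^esub> (poly_of_const d \<oplus>\<^bsub>?P\<^esub> Q \<otimes>\<^bsub>?P\<^esub> r)"
    using Q(1) d r(1) by (simp add: UP.r_distr UP.m_assoc)
  moreover have "Q \<otimes>\<^bsub>?P\<^esub> Q \<otimes>\<^bsub>?P\<^esub> s = Q \<otimes>\<^bsub>?P\<^esub> (Q \<otimes>\<^bsub>?P\<^esub> s)"
    using Q(1) s(1) by (simp add: UP.m_assoc)
  ultimately have "Q \<otimes>\<^bsub>?P\<^esub> (poly_of_const d \<oplus>\<^bsub>?P\<^esub> Q \<otimes>\<^bsub>?P\<^esub> r) = Q \<otimes>\<^bsub>?P\<^esub> (Q \<otimes>\<^bsub>?P\<^esub> s)"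
    by simp
  moreover have "poly_of_const d \<oplus>\<^bsub>?P\<^esub> Q \<otimes>\<^bsub>?P\<^esub> r \<in> carrier ?P" "Q \<otimes>\<^bsub>?P\<^esub> s \<in> carrier ?P"
    using Q(1) d r(1) s(1) by auto
  ultimately have "poly_of_const d \<oplus>\<^bsub>?P\<^esub> Q \<otimes>\<^bsub>?P\<^esub> r = Q \<otimes>\<^bsub>?P\<^esub> s"
    using UP.m_lcancel[OF Q0 Q(1)] by blast
  then have "eval (poly_of_const d \<oplus>\<^bsub>?P\<^esub> Q \<otimes>\<^bsub>?P\<^esub> r) a = eval (Q \<otimes>\<^bsub>?P\<^esub> s) a" by simp
  then show ?thesis
    using Q(1,3) d r(1) s(1) a by (simp add: eval_poly_of_const d_def[symmetric])
qed

text \<open>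
  At a double root the derivative, a nonzero polynomial of smaller degree, would vanish as well.
\<close>

lemma (in field) Irr_simple_root_char_zero:
  assumes char: "\<And>n::nat. n > 0 \<Longrightarrow> [n] \<cdot> \<one> \<noteq> \<zero>"
    and K: "subfield K R" and a: "a \<in> carrier R" "(algebraic over K) a"
  shows "alg_mult (Irr K a) a \<le> 1"
proof (rule ccontr)
  note K_ring = subfieldE(1)[OF K]
  note f = IrrE[OF K a]
  have f_carr: "Irr K a \<in> carrier (poly_ring R)" by (rule carrier_polynomial_shell[OF K_ring f(1)])
  have deg: "degree (Irr K a) \<ge> 1" by (rule pirreducible_degree[OF K f(1,2)])
  assume "\<not> alg_mult (Irr K a) a \<le> 1"
  then have "[\<one>, \<ominus> a] [^]\<^bsub>poly_ring R\<^esub> (2::nat) pdivides Irr K a"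
    by (intro le_alg_mult_imp_pdivides a f_carr) simp
  then have root: "eval (formal_deriv (Irr K a)) a = \<zero>"
    by (rule double_root_imp_deriv_root[OF f_carr a(1)])
  obtain c d cs where cs: "Irr K a = c # d # cs"
    using deg by (cases "Irr K a"; cases "tl (Irr K a)") auto
  have "c = \<one>" using f(3) cs by simp
  have "formal_deriv (Irr K a) \<in> carrier (K[X])"
    using formal_deriv_mem_subring[OF K_ring univ_poly_coeffs[OF f(1)]] char[of "Suc (length cs)"]
    by (simp add: univ_poly_carrier[symmetric] polynomial_def cs \<open>c = \<one>\<close>)
  then have "degree (Irr K a) \<le> degree (formal_deriv (Irr K a))"
    using pdivides_imp_degree_le[OF K_ring f(1) _ _ Irr_minimal[OF K a _ root]] by (simp add: cs)
  then show False by (simp add: length_formal_deriv cs)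
qed

text \<open>
  Write \<open>x = g(x^p)\<close>. The minimal polynomial of \<open>x\<close> divides \<open>h = X - g(X^p)\<close>, and at a root \<open>a\<close>
  of \<open>h\<close> the polynomial \<open>g(X^p) - g(a^p)\<close> is a multiple of \<open>X^p - a^p = (X - a)^p\<close>. So \<open>h\<close> is
  congruent to \<open>X - a\<close> modulo \<open>(X - a)\<^sup>2\<close> and has no double root.
\<close>

lemma (in field) frob_sep_imp_simple_root_char_prime:
  assumes char: "normalization_semidom_class.prime char_exp" "[char_exp] \<cdot> \<one> = \<zero>"
    and K: "subfield K R" and x: "x \<in> carrier R" "frob_sep K x"
    and a: "a \<in> carrier R"
  shows "alg_mult (Irr K x) a \<le> 1"
proof (rule ccontr)
  note K_ring = subfieldE(1)[OF K]
  have alg: "(algebraic over K) x" using x by (simp add: frob_sep_def)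
  note f = IrrE[OF K x(1) alg]
  have f_carr: "Irr K x \<in> carrier (poly_ring R)" by (rule carrier_polynomial_shell[OF K_ring f(1)])
  let ?P = "poly_ring R"
  interpret UP: domain ?P by (rule univ_poly_is_domain[OF carrier_is_subring])
  interpret C: ring_hom_ring R ?P poly_of_const by (rule poly_of_const_hom)
  have ev: "ring_hom_ring ?P R (\<lambda>p. eval p y)" if "y \<in> carrier R" for y
    by (rule eval_ring_hom[OF carrier_is_subring that])
  define Q where "Q = [\<one>, \<ominus> a]"
  note Q = linear_factor[OF a, folded Q_def]
  have Q0: "Q \<noteq> \<zero>\<^bsub>?P\<^esub>" by (simp add: Q_def univ_poly_zero)
  define p where "p = char_exp"
  obtain g where g: "g \<in> carrier (K[X])" "eval g (frob x) = x"
    using x simple_extension_as_eval_img[OF subfieldE(3)[OF K], of "frob x"]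
    unfolding frob_sep_def by auto
  have g_K: "set g \<subseteq> K" using univ_poly_coeffs[OF g(1)] .
  then have g_carr: "set g \<subseteq> carrier R" using subfieldE(3)[OF K] by auto
  define Cg where "Cg = map poly_of_const g"
  have Cg: "set Cg \<subseteq> carrier ?P" using g_carr by (auto simp: Cg_def)
  have X_carr: "X \<in> carrier ?P" by (rule var_closed(1)[OF carrier_is_subring])
  define G where "G = poly_compose g (X [^]\<^bsub>?P\<^esub> p)"
  define h where "h = X \<ominus>\<^bsub>?P\<^esub> G"
  have G_carr: "G \<in> carrier ?P"
    unfolding G_def using g_carr X_carr by (intro poly_compose_closed carrier_is_subring) auto
  have eval_h: "eval h y = y \<ominus> eval g (frob y)" if y: "y \<in> carrier R" for y
  proof -
    interpret ev: ring_hom_ring ?P R "\<lambda>p. eval p y" by (rule ev[OF y])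
    have "eval (X [^]\<^bsub>?P\<^esub> p) y = frob y"
      using ev.hom_nat_pow[OF X_carr, of p] y by (simp add: eval_var frob_def p_def)
    then have "eval G y = eval g (frob y)"
      unfolding G_def using eval_poly_compose[OF g_carr _ y, of "X [^]\<^bsub>?P\<^esub> p"] X_carr by simp
    then show ?thesis
      using G_carr X_carr y by (simp add: h_def a_minus_def eval_var)
  qed
  have h_K: "h \<in> carrier (K[X])"
  proof -
    note sub = univ_poly_subring[OF K_ring]
    have XK: "X \<in> carrier (K[X])" by (rule var_closed(1)[OF K_ring])
    have "X [^]\<^bsub>?P\<^esub> n \<in> carrier (K[X])" for n :: nat
      using XK subringE(3,6)[OF sub] by (induction n) auto
    then have "G \<in> carrier (K[X])" unfolding G_def using g_K by (intro poly_compose_closed[OF K_ring])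
    then show ?thesis
      unfolding h_def a_minus_def using XK subringE(5,7)[OF sub] by blast
  qed
  have "eval h x = \<zero>" using eval_h[OF x(1)] g(2) x(1) by (simp add: r_neg a_minus_def)
  then have dvd: "Irr K x pdivides h" by (rule Irr_minimal[OF K x(1) alg h_K])
  assume "\<not> alg_mult (Irr K x) a \<le> 1"
  then have "Q [^]\<^bsub>?P\<^esub> (2::nat) pdivides Irr K x"
    unfolding Q_def by (intro le_alg_mult_imp_pdivides a f_carr) simp
  then have "Q [^]\<^bsub>?P\<^esub> (2::nat) pdivides h"
    using dvd UP.divides_trans Q(1) unfolding pdivides_def by blast
  then obtain s where s: "s \<in> carrier ?P" "h = (Q \<otimes>\<^bsub>?P\<^esub> Q) \<otimes>\<^bsub>?P\<^esub> s"
    using Q(1) by (auto simp: pdivides_def factor_def numeral_2_eq_2)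
  have "eval h a = \<zero>"
  proof -
    interpret ev: ring_hom_ring ?P R "\<lambda>p. eval p a" by (rule ev[OF a])
    show ?thesis unfolding s(2) using Q(1,3) s(1) by simp
  qed
  then have "a \<ominus> eval g (frob a) = \<zero>" using eval_h[OF a] by simp
  then have ga: "eval g (frob a) = a"
    using iffD1[OF r_right_minus_eq[OF a eval_in_carrier[OF g_carr frob_closed[OF a]]]] sym by metis
  have "[p] \<cdot>\<^bsub>?P\<^esub> \<one>\<^bsub>?P\<^esub> = \<zero>\<^bsub>?P\<^esub>"
  proof -
    have "[n] \<cdot>\<^bsub>?P\<^esub> \<one>\<^bsub>?P\<^esub> = poly_of_const ([n] \<cdot> \<one>)" for n :: nat
      by (induction n) simp_all
    then show ?thesis using char(2) by (simp add: p_def)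
  qed
  then have Xp: "X [^]\<^bsub>?P\<^esub> p = poly_of_const (frob a) \<oplus>\<^bsub>?P\<^esub> Q [^]\<^bsub>?P\<^esub> p"
    using UP.freshmans_dream[of p "poly_of_const a" Q] char(1) a Q(1)
      C.hom_nat_pow[OF a, of p] unfolding Q(2) by (simp add: p_def frob_def)
  \<comment> \<open>The exponent \<open>p \<ge> 2\<close> makes \<open>(X - a)^p\<close> a multiple of \<open>(X - a)\<^sup>2\<close>.\<close>
  obtain m where "p = 2 + m"
    using prime_ge_2_nat[OF char(1)] le_Suc_ex unfolding p_def by blast
  then have m: "p = Suc (Suc m)" by simp
  define Qp where "Qp = Q [^]\<^bsub>?P\<^esub> p"
  have Qp: "Qp \<in> carrier ?P" using Q(1) by (simp add: Qp_def)
  obtain r where r: "r \<in> carrier ?P" "G = poly_of_const (eval g (frob a)) \<oplus>\<^bsub>?P\<^esub> Qp \<otimes>\<^bsub>?P\<^esub> r"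
  proof -
    define D where "D = UP.eval (UP.formal_deriv Cg) (poly_of_const (frob a))"
    have D: "D \<in> carrier ?P"
      unfolding D_def using a UP.formal_deriv_mem_subring[OF UP.carrier_is_subring Cg]
      by (intro UP.eval_in_carrier) auto
    obtain r where r: "r \<in> carrier ?P"
      "UP.eval Cg (poly_of_const (frob a) \<oplus>\<^bsub>?P\<^esub> Qp)
        = UP.eval Cg (poly_of_const (frob a)) \<oplus>\<^bsub>?P\<^esub> Qp \<otimes>\<^bsub>?P\<^esub> D \<oplus>\<^bsub>?P\<^esub> Qp \<otimes>\<^bsub>?P\<^esub> Qp \<otimes>\<^bsub>?P\<^esub> r"
      using UP.eval_Taylor[OF _ Qp Cg, of "poly_of_const (frob a)"] a unfolding D_def by auto
    have "UP.eval Cg (poly_of_const (frob a)) = poly_of_const (eval g (frob a))"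
      unfolding Cg_def using C.eval_hom'[of "frob a" g] a g_carr by simp
    moreover have "poly_of_const (eval g (frob a)) \<in> carrier ?P"
      using ga a by simp
    ultimately have "G = poly_of_const (eval g (frob a)) \<oplus>\<^bsub>?P\<^esub> Qp \<otimes>\<^bsub>?P\<^esub> (D \<oplus>\<^bsub>?P\<^esub> Qp \<otimes>\<^bsub>?P\<^esub> r)"
      using r(1) D Qp unfolding G_def poly_compose_def Cg_def[symmetric] Xp Qp_def[symmetric] r(2)
      by (simp add: UP.r_distr UP.m_assoc UP.a_assoc)
    moreover have "D \<oplus>\<^bsub>?P\<^esub> Qp \<otimes>\<^bsub>?P\<^esub> r \<in> carrier ?P" using r(1) D Qp by simp
    ultimately show thesis by (rule that[rotated])
  qed
  define t where "t = Q [^]\<^bsub>?P\<^esub> m"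
  have t: "t \<in> carrier ?P" using Q(1) by (simp add: t_def)
  have "Qp = Q \<otimes>\<^bsub>?P\<^esub> Q \<otimes>\<^bsub>?P\<^esub> t"
  proof -
    have "Qp = t \<otimes>\<^bsub>?P\<^esub> Q \<otimes>\<^bsub>?P\<^esub> Q" by (simp add: Qp_def m t_def)
    then show ?thesis using Q(1) t by (simp only: UP.m_ac UP.m_closed)
  qed
  then have "h = (poly_of_const a \<oplus>\<^bsub>?P\<^esub> Q) \<ominus>\<^bsub>?P\<^esub> (poly_of_const a \<oplus>\<^bsub>?P\<^esub> Q \<otimes>\<^bsub>?P\<^esub> Q \<otimes>\<^bsub>?P\<^esub> t \<otimes>\<^bsub>?P\<^esub> r)"
    unfolding h_def r(2) ga Q(2) by simp
  also have "\<dots> = Q \<otimes>\<^bsub>?P\<^esub> (\<one>\<^bsub>?P\<^esub> \<ominus>\<^bsub>?P\<^esub> Q \<otimes>\<^bsub>?P\<^esub> (t \<otimes>\<^bsub>?P\<^esub> r))"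
  proof -
    define c where "c = poly_of_const a"
    have "c \<in> carrier ?P" using a by (simp add: c_def)
    then have "(c \<oplus>\<^bsub>?P\<^esub> Q) \<ominus>\<^bsub>?P\<^esub> (c \<oplus>\<^bsub>?P\<^esub> Q \<otimes>\<^bsub>?P\<^esub> Q \<otimes>\<^bsub>?P\<^esub> t \<otimes>\<^bsub>?P\<^esub> r)
        = Q \<ominus>\<^bsub>?P\<^esub> Q \<otimes>\<^bsub>?P\<^esub> (Q \<otimes>\<^bsub>?P\<^esub> (t \<otimes>\<^bsub>?P\<^esub> r))"
      using Q(1) t r(1) by algebra
    also have "\<dots> = Q \<otimes>\<^bsub>?P\<^esub> (\<one>\<^bsub>?P\<^esub> \<ominus>\<^bsub>?P\<^esub> Q \<otimes>\<^bsub>?P\<^esub> (t \<otimes>\<^bsub>?P\<^esub> r))"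
      using Q(1) t r(1) by (simp add: a_minus_def UP.r_distr UP.r_minus)
    finally show ?thesis unfolding c_def .
  qed
  finally have "Q \<otimes>\<^bsub>?P\<^esub> (\<one>\<^bsub>?P\<^esub> \<ominus>\<^bsub>?P\<^esub> Q \<otimes>\<^bsub>?P\<^esub> (t \<otimes>\<^bsub>?P\<^esub> r)) = Q \<otimes>\<^bsub>?P\<^esub> (Q \<otimes>\<^bsub>?P\<^esub> s)"
    using s Q(1) by (simp add: UP.m_assoc)
  then have "\<one>\<^bsub>?P\<^esub> \<ominus>\<^bsub>?P\<^esub> Q \<otimes>\<^bsub>?P\<^esub> (t \<otimes>\<^bsub>?P\<^esub> r) = Q \<otimes>\<^bsub>?P\<^esub> s"
    using UP.m_lcancel[OF Q0 Q(1), of "\<one>\<^bsub>?P\<^esub> \<ominus>\<^bsub>?P\<^esub> Q \<otimes>\<^bsub>?P\<^esub> (t \<otimes>\<^bsub>?P\<^esub> r)" "Q \<otimes>\<^bsub>?P\<^esub> s"]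
      Q(1) s(1) t r(1) by blast
  then have eq: "eval (\<one>\<^bsub>?P\<^esub> \<ominus>\<^bsub>?P\<^esub> Q \<otimes>\<^bsub>?P\<^esub> (t \<otimes>\<^bsub>?P\<^esub> r)) a = eval (Q \<otimes>\<^bsub>?P\<^esub> s) a" by simp
  interpret ev: ring_hom_ring ?P R "\<lambda>p. eval p a" by (rule ev[OF a])
  from eq have "\<one> = \<zero>"
    using Q(1,3) s(1) t r(1) by (simp add: a_minus_def)
  then show False by simp
qed

lemma (in domain) frob_inj:
  assumes "x \<in> carrier R" "y \<in> carrier R" "frob x = frob y" shows "x = y"
proof -
  interpret frob: ring_hom_ring R R frob by (rule frob_ring_hom_ring)
  have "frob (x \<ominus> y) = \<zero>" using assms by (simp add: a_minus_def r_neg)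
  moreover have "z [^] (n::nat) = \<zero> \<Longrightarrow> z \<in> carrier R \<Longrightarrow> z = \<zero>" for z n
    by (induction n) (auto simp: integral_iff)
  ultimately have "x \<ominus> y = \<zero>" using assms by (simp add: frob_def)
  then show ?thesis using assms by simp
qed

text \<open>
  Let \<open>M = K[x^p]\<close>. The minimal polynomial \<open>g\<close> of \<open>x\<close> over \<open>M\<close> divides \<open>X^p - x^p\<close>, whose only root
  is \<open>x\<close>. It also divides the minimal polynomial over \<open>K\<close>, where \<open>x\<close> is a simple root. Hence \<open>g\<close>
  is linear and \<open>x \<in> M\<close>.
\<close>

lemma (in field) simple_root_imp_frob_sep:
  assumes K: "subfield K R" and x: "x \<in> carrier R" "(algebraic over K) x"
    and mult: "alg_mult (Irr K x) x \<le> 1"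
    and split: "\<And>p. p \<in> carrier (poly_ring R) \<Longrightarrow> splitted p"
  shows "frob_sep K x"
proof -
  note K_ring = subfieldE(1)[OF K] and K_carr = subfieldE(3)[OF K]
  let ?P = "poly_ring R"
  interpret UP: domain ?P by (rule univ_poly_is_domain[OF carrier_is_subring])
  define M where "M = simple_extension K (frob x)"
  have fx: "frob x \<in> carrier R" using x by simp
  have "frob x \<in> simple_extension K x"
    by (intro frob_mem_subring simple_extension_is_subring[OF K_ring x(1)] simple_extension_mem[OF K_ring x(1)])
  then have M: "subfield M R"
    unfolding M_def using simple_extension_is_subfield[OF K fx] simple_extesion_mem_imp_algebraic[OF K x]
    by simp
  note M_ring = subfieldE(1)[OF M]
  have KM: "K \<subseteq> M" unfolding M_def by (rule simple_extension_incl[OF K_carr fx])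
  have fxM: "frob x \<in> M" unfolding M_def by (rule simple_extension_mem[OF K_ring fx])
  have algM: "(algebraic over M) x" by (rule algebraic_mono[OF KM x(2)])
  define g where "g = Irr M x"
  note g = IrrE[OF M x(1) algM, folded g_def]
  have g_carr: "g \<in> carrier ?P" by (rule carrier_polynomial_shell[OF M_ring g(1)])
  have f: "Irr K x \<in> carrier (M[X])"
    using IrrE(1)[OF K x] KM unfolding univ_poly_carrier[symmetric] polynomial_def by auto
  have f0: "Irr K x \<noteq> []" by (rule pirreducibleE(1)[OF K_ring IrrE(1,2)[OF K x]])
  have "roots g \<subseteq># roots (Irr K x)"
    using Irr_minimal[OF M x(1) algM f IrrE(4)[OF K x]] f0
    by (intro pdivides_imp_roots_incl g_carr carrier_polynomial_shell[OF M_ring f]) (simp_all add: g_def)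
  then have count_x: "count (roots g) x \<le> 1"
    using mult alg_mult_eq_count_roots[OF carrier_polynomial_shell[OF M_ring f]] mset_subset_eq_count
    by (metis le_trans)
  have only_x: "y = x" if "y \<in># roots g" for y
  proof -
    have y: "y \<in> carrier R" "eval g y = \<zero>"
      using that roots_mem_iff_is_root[OF g_carr] by (auto simp: is_root_def)
    obtain q where q: "q \<in> carrier (M[X])" "\<And>z. z \<in> carrier R \<Longrightarrow> eval q z = frob z \<ominus> frob x"
      using obtain_power_minus_const[OF M_ring fxM char_exp_pos] unfolding frob_def by metis
    have "g pdivides q"
      unfolding g_def using q(2)[OF x(1)] x(1)
      by (intro Irr_minimal[OF M x(1) algM q(1)]) (simp add: a_minus_def r_neg)
    then have "eval q y = \<zero>" using pdivides_imp_root_sharing[OF g_carr _ y(1)] y(2) by blast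
    then have "frob y = frob x" using q(2)[OF y(1)] y(1) fx by simp
    then show ?thesis using frob_inj y(1) x(1) by blast
  qed
  have "roots g \<subseteq># {#x#}"
  proof (rule mset_subset_eqI)
    fix y show "count (roots g) y \<le> count {#x#} y"
      using count_x only_x[of y] by (cases "y = x") (auto simp: count_eq_zero_iff)
  qed
  then have "size (roots g) \<le> 1" using size_mset_mono by fastforce
  then have "degree g \<le> 1" using split[OF g_carr] by (simp add: splitted_def)
  then have "degree g = 1" using pirreducible_degree[OF M g(1,2)] by simp
  then obtain b where b: "g = [\<one>, b]" "b \<in> M"
    using g(1,3) by (elim degree_oneE) auto
  have "x \<oplus> b = \<zero>" using g(4) b x subfieldE(3)[OF M] by auto
  then have "x = \<ominus> b" using x b subfieldE(3)[OF M] by (metis minus_equality add.m_comm subsetD)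
  then have "x \<in> M" using b(2) subringE(5)[OF M_ring] by simp
  then show ?thesis using x(2) by (simp add: frob_sep_def M_def)
qed

lemma (in algebraically_closed) separable_algebraic_iff_frob_sep:
  assumes K: "subfield K L" and x: "x \<in> carrier L"
  shows "separable_algebraic K x \<longleftrightarrow> frob_sep K x"
proof
  assume "separable_algebraic K x"
  then show "frob_sep K x"
    using x simple_root_imp_frob_sep[OF K x] roots_over_carrier by (simp add: separable_algebraic_def)
next
  assume sep: "frob_sep K x"
  then have alg: "(algebraic over K) x" by (simp add: frob_sep_def)
  have "alg_mult (Irr K x) a \<le> 1" if a: "a \<in> carrier L" for a
  proof (cases rule: char_exp_cases)
    case prime
    show ?thesis by (rule frob_sep_imp_simple_root_char_prime[OF prime K x sep a])
  next
    case zero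
    show ?thesis
    proof (cases "eval (Irr K x) a = \<zero>")
      case True
      then show ?thesis
        using Irr_simple_root_char_zero[OF zero(2) K a] Irr_root[OF K x alg a] by simp
    next
      case False
      then have "\<not> is_root (Irr K x) a" by (simp add: is_root_def)
      then show ?thesis
        using alg_mult_gt_zero_iff_is_root[OF carrier_polynomial_shell[OF subfieldE(1)[OF K] IrrE(1)[OF K x alg]], of a]
        by simp
    qed
  qed
  then show "separable_algebraic K x" using alg by (simp add: separable_algebraic_def)
qed

lemma (in algebraically_closed) frob_sep_conjugate:
  assumes K: "subfield K L" and x: "x \<in> carrier L" "frob_sep K x"
    and y: "y \<in> carrier L" "eval (Irr K x) y = \<zero>"
  shows "frob_sep K y"
proof -
  have alg: "(algebraic over K) x" using x by (simp add: frob_sep_def)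
  have "separable_algebraic K x" using separable_algebraic_iff_frob_sep[OF K] x by blast
  then have "separable_algebraic K y"
    using Irr_root[OF K x(1) alg y] by (simp add: separable_algebraic_def)
  then show ?thesis using separable_algebraic_iff_frob_sep[OF K] y by blast
qed

section \<open>Linear disjointness from separable extensions\<close>

text \<open>
  The coefficients of a monic polynomial are polynomials in its roots; split off one linear factor
  at a time.
\<close>

lemma (in field) splitted_monic_coeffs_mem:
  assumes E: "subfield E R"
  shows "\<lbrakk>p \<in> carrier (poly_ring R); p \<noteq> []; lead_coeff p = \<one>; splitted p;
      \<And>a. a \<in># roots p \<Longrightarrow> a \<in> E\<rbrakk> \<Longrightarrow> p \<in> carrier (E[X])"
proof (induction "length p" arbitrary: p rule: less_induct)
  case less
  note E_ring = subfieldE(1)[OF E]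
  note p = less.prems
  let ?P = "poly_ring R"
  interpret UP: domain ?P by (rule univ_poly_is_domain[OF carrier_is_subring])
  show ?case
  proof (cases "degree p = 0")
    case True
    then have "p = [\<one>]" using p(2,3) by (cases p) auto
    then show ?thesis
      using subringE(3)[OF E_ring] unfolding univ_poly_carrier[symmetric] polynomial_def by simp
  next
    case False
    then have "roots p \<noteq> {#}" using p(4) by (auto simp: splitted_def)
    then obtain a where a: "a \<in> carrier R" "a \<in># roots p" "[\<one>, \<ominus> a] pdivides p"
      using not_empty_rootsE[OF p(1)] by blast
    define Q where "Q = [\<one>, \<ominus> a]"
    note Q = linear_factor(1)[OF a(1), folded Q_def]
    obtain q where q: "q \<in> carrier ?P" "p = Q \<otimes>\<^bsub>?P\<^esub> q"
      using a(3) by (auto simp: pdivides_def factor_def Q_def)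
    have q0: "q \<noteq> []"
      using p(2) q(2) UP.r_null[OF Q] by (auto simp: univ_poly_zero)
    have polys: "polynomial (carrier R) Q" "polynomial (carrier R) q"
      using Q q(1) by (simp_all add: univ_poly_carrier)
    have Q0: "Q \<noteq> []" by (simp add: Q_def)
    have "lead_coeff p = lead_coeff Q \<otimes> lead_coeff q"
      using poly_mult_lead_coeff[OF carrier_is_subring polys Q0 q0] q(2) by (simp add: univ_poly_mult)
    moreover have "lead_coeff q \<in> carrier R"
      using univ_poly_coeffs[OF q(1)] q0 by (cases q) auto
    ultimately have lead: "lead_coeff q = \<one>" using p(3) by (simp add: Q_def)
    have "degree p = degree Q + degree q"
      using poly_mult_degree_eq[OF carrier_is_subring polys] Q0 q0 q(2) by (simp add: univ_poly_mult)
    then have len: "length q < length p"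
      using p(2) q0 by (cases p; cases q) (auto simp: Q_def)
    have dvd: "q pdivides p"
      unfolding pdivides_def using q Q by (intro dividesI[of Q]) (auto simp: UP.m_comm)
    have "q \<in> carrier (E[X])"
    proof (rule less.hyps[OF len q(1) q0 lead])
      show "splitted q" by (rule pdivides_imp_splitted[OF q(1) p(1,2,4) dvd])
      show "b \<in> E" if "b \<in># roots q" for b
        using mset_subset_eqD[OF pdivides_imp_roots_incl[OF q(1) p(1,2) dvd] that] p(5) by blast
    qed
    moreover have "Q \<in> carrier (E[X])"
      using subringE(3,5)[OF E_ring] p(5)[OF a(2)]
      unfolding univ_poly_carrier[symmetric] polynomial_def Q_def by simp
    ultimately show ?thesis
      unfolding q(2) by (intro subringE(6)[OF univ_poly_subring[OF E_ring]])
  qed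
qed

text \<open>
  Newton interpolation: split off \<open>f(a)\<close> for one node \<open>a\<close>. The quotient \<open>(f - f(a)) / (X - a)\<close> has
  smaller degree and takes values in \<open>E\<close> at the other nodes.
\<close>

lemma (in field) interpolation_coeffs_mem:
  assumes E: "subfield E R"
  shows "\<lbrakk>f \<in> carrier (poly_ring R); finite A; A \<subseteq> E; length f \<le> card A;
      \<And>a. a \<in> A \<Longrightarrow> eval f a \<in> E\<rbrakk> \<Longrightarrow> f \<in> carrier (E[X])"
proof (induction "length f" arbitrary: f A rule: less_induct)
  case less
  note E_ring = subfieldE(1)[OF E] and E_carr = subfieldE(3)[OF E]
  note f = less.prems
  let ?P = "poly_ring R"
  interpret UP: domain ?P by (rule univ_poly_is_domain[OF carrier_is_subring])
  show ?case
  proof (cases "f = []")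
    case True
    then show ?thesis by (simp add: univ_poly_zero_closed)
  next
    case False
    then have "card A \<noteq> 0" using f(4) by (cases f) auto
    then obtain a where a: "a \<in> A" by fastforce
    then have aE: "a \<in> E" and a_carr: "a \<in> carrier R" using f(3) E_carr by auto
    define c where "c = eval f a"
    have c: "c \<in> E" "c \<in> carrier R" using f(5)[OF a] E_carr by (auto simp: c_def)
    have C: "poly_of_const c \<in> carrier ?P" by (rule poly_of_const_mem[OF c(2)])
    define h where "h = f \<ominus>\<^bsub>?P\<^esub> poly_of_const c"
    have h: "h \<in> carrier ?P" unfolding h_def using f(1) C by simp
    have eval_h: "eval h b = eval f b \<ominus> c" if b: "b \<in> carrier R" for b
    proof -
      interpret ev: ring_hom_ring ?P R "\<lambda>p. eval p b" by (rule eval_ring_hom[OF carrier_is_subring b])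
      show ?thesis using f(1) C b c by (simp add: h_def a_minus_def eval_poly_of_const)
    qed
    define Q where "Q = [\<one>, \<ominus> a]"
    note Q = linear_factor(1)[OF a_carr, folded Q_def]
    have "Q pdivides h"
    proof (cases "h = []")
      case True
      then show ?thesis using pdivides_zero[OF carrier_is_subring Q] by simp
    next
      case False
      have "eval h a = \<zero>" using eval_h[OF a_carr] c by (simp add: c_def[symmetric] a_minus_def r_neg)
      then show ?thesis
        unfolding Q_def using is_root_imp_pdivides[OF h] False a_carr by (simp add: is_root_def)
    qed
    then obtain g where g: "g \<in> carrier ?P" "h = Q \<otimes>\<^bsub>?P\<^esub> g"
      by (auto simp: pdivides_def factor_def)
    have g_E: "g \<in> carrier (E[X])"
    proof (cases "g = []")
      case True
      then show ?thesis by (simp add: univ_poly_zero_closed)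
    next
      case g0: False
      have polys: "polynomial (carrier R) Q" "polynomial (carrier R) g"
        using Q g(1) by (simp_all add: univ_poly_carrier)
      have "degree h = 1 + degree g"
        using poly_mult_degree_eq[OF carrier_is_subring polys] g0 g(2) by (simp add: univ_poly_mult Q_def)
      then have "length h = Suc (length g)" using g0 by (cases g; cases h) auto
      moreover have "length h \<le> max (length f) (length (\<ominus>\<^bsub>?P\<^esub> poly_of_const c))"
        unfolding h_def a_minus_def univ_poly_add by (rule poly_add_length_le)
      moreover have "length (\<ominus>\<^bsub>?P\<^esub> poly_of_const c) \<le> 1"
        using univ_poly_a_inv_length[OF carrier_is_subring C] by (simp add: poly_of_const_def)
      moreover have "1 \<le> length f" using False by (cases f) auto
      ultimately have len: "length g < length f" by simp
      show ?thesis
      proof (rule less.hyps[OF len g(1), of "A - {a}"])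
        show "length g \<le> card (A - {a})" using len f(2,4) a by simp
        fix b assume b: "b \<in> A - {a}"
        then have bE: "b \<in> E" and b_carr: "b \<in> carrier R" using f(3) E_carr by auto
        interpret ev: ring_hom_ring ?P R "\<lambda>p. eval p b" by (rule eval_ring_hom[OF carrier_is_subring b_carr])
        define y where "y = eval g b"
        have y: "y \<in> carrier R" unfolding y_def using g(1) by (rule ev.hom_closed)
        have "eval Q b = b \<ominus> a" using b_carr a_carr by (simp add: Q_def a_minus_def)
        then have eq: "eval f b \<ominus> c = (b \<ominus> a) \<otimes> y"
          using eval_h[OF b_carr] Q g(1) unfolding g(2) y_def by simp
        have ba: "b \<ominus> a \<in> E - {\<zero>}"
          using b aE bE a_carr b_carr subringE(5,7)[OF E_ring] by (auto simp: a_minus_def[of _ b a] r_right_minus_eq[unfolded a_minus_def])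
        then have "inv (b \<ominus> a) \<in> E" "inv (b \<ominus> a) \<otimes> (b \<ominus> a) = \<one>"
          using subfield_m_inv[OF E ba] by auto
        moreover have "eval f b \<ominus> c \<in> E"
          using f(5)[of b] b c(1) subringE(5,7)[OF E_ring] by (auto simp: a_minus_def)
        moreover have "y = inv (b \<ominus> a) \<otimes> ((b \<ominus> a) \<otimes> y)"
          using y ba E_carr calculation(1,2) m_assoc[of "inv (b \<ominus> a)" "b \<ominus> a" y] by auto
        ultimately show "eval g b \<in> E"
          using subringE(6)[OF E_ring] unfolding y_def[symmetric] eq by metis
      qed (use f(2,3) in auto)
    qed
    have "f = Q \<otimes>\<^bsub>?P\<^esub> g \<oplus>\<^bsub>?P\<^esub> poly_of_const c"
    proof -
      have "f = h \<oplus>\<^bsub>?P\<^esub> poly_of_const c"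
        unfolding h_def using f(1) C by (simp add: a_minus_def UP.a_assoc UP.l_neg)
      then show ?thesis unfolding g(2) .
    qed
    moreover have "Q \<in> carrier (E[X])"
      using subringE(3)[OF E_ring] subringE(5)[OF E_ring aE]
      unfolding univ_poly_carrier[symmetric] polynomial_def Q_def by simp
    ultimately show ?thesis
      using g_E poly_of_const_mem[OF c(1)] subringE(6,7)[OF univ_poly_subring[OF E_ring]] by simp
  qed
qed

text \<open>
  The field \<open>E\<close> contains the roots, hence the coefficients, of the minimal polynomial of \<open>b\<close> over
  \<open>F\<close>. So this polynomial is defined over \<open>E \<inter> F \<subseteq> K\<close>. In the applications \<open>E\<close> is the field of all
  elements that are algebraic, or separable, over \<open>K\<close>.
\<close>

lemma (in algebraically_closed) degree_Irr_eq:
  assumes K: "subfield K L" and F: "subfield F L" "K \<subseteq> F" and E: "subfield E L" "E \<inter> F \<subseteq> K"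
    and b: "b \<in> carrier L" "(algebraic over K) b"
    and conj: "\<And>y. y \<in> carrier L \<Longrightarrow> eval (Irr K b) y = \<zero> \<Longrightarrow> y \<in> E"
  shows "degree (Irr F b) = degree (Irr K b)"
proof -
  note K_ring = subfieldE(1)[OF K] and F_ring = subfieldE(1)[OF F(1)]
  have algF: "(algebraic over F) b" by (rule algebraic_mono[OF F(2) b(2)])
  note g = IrrE[OF F(1) b(1) algF] and f = IrrE[OF K b]
  have g0: "Irr F b \<noteq> []" by (rule pirreducibleE(1)[OF F_ring g(1,2)])
  have f0: "Irr K b \<noteq> []" by (rule pirreducibleE(1)[OF K_ring f(1,2)])
  have g_carr: "Irr F b \<in> carrier (poly_ring L)" by (rule carrier_polynomial_shell[OF F_ring g(1)])
  have fF: "Irr K b \<in> carrier (F[X])"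
    using f(1) F(2) unfolding univ_poly_carrier[symmetric] polynomial_def by auto
  have dvd: "Irr F b pdivides Irr K b" by (rule Irr_minimal[OF F(1) b(1) algF fF f(4)])
  have "Irr F b \<in> carrier (E[X])"
  proof (rule splitted_monic_coeffs_mem[OF E(1) g_carr g0 g(3) roots_over_carrier[OF g_carr]])
    fix a assume "a \<in># roots (Irr F b)"
    then have "a \<in> carrier L" "eval (Irr F b) a = \<zero>"
      using roots_mem_iff_is_root[OF g_carr] by (auto simp: is_root_def)
    then show "a \<in> E" using conj pdivides_imp_root_sharing[OF g_carr dvd] by blast
  qed
  then have "set (Irr F b) \<subseteq> K"
    using univ_poly_coeffs[OF g(1)] univ_poly_coeffs[of "Irr F b" E] E(2) by blast
  then have gK: "Irr F b \<in> carrier (K[X])" by (rule univ_poly_carrier_restrict[OF g(1)])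
  have "degree (Irr K b) \<le> degree (Irr F b)"
    by (rule pdivides_imp_degree_le[OF K_ring f(1) gK g0 Irr_minimal[OF K b gK g(4)]])
  moreover have "degree (Irr F b) \<le> degree (Irr K b)"
    by (rule pdivides_imp_degree_le[OF F_ring g(1) fF f0 dvd])
  ultimately show ?thesis by simp
qed

lemma (in algebraically_closed) linearly_disjoint_simple_extension:
  assumes K: "subfield K L" and F: "subfield F L" "K \<subseteq> F" and E: "subfield E L" "E \<inter> F \<subseteq> K"
    and b: "b \<in> carrier L" "(algebraic over K) b"
    and conj: "\<And>y. y \<in> carrier L \<Longrightarrow> eval (Irr K b) y = \<zero> \<Longrightarrow> y \<in> E"
  shows "linearly_disjoint K F (simple_extension K b)"
  unfolding linearly_disjoint_def
proof (intro allI impI)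
  fix us assume us: "set us \<subseteq> F" "independent K us"
  have Kb: "subfield (simple_extension K b) L"
    using simple_extension_is_subfield[OF K b(1)] b(2) by simp
  have algF: "(algebraic over F) b" by (rule algebraic_mono[OF F(2) b(2)])
  define vs where "vs = exp_base b (degree (Irr K b))"
  have "independent F vs"
    using exp_base_independent[OF F(1) b(1) algF] degree_Irr_eq[OF K F E b conj]
    by (simp add: vs_def)
  moreover have "Span K vs = simple_extension K b"
    unfolding vs_def by (rule Span_exp_base[OF K b])
  ultimately show "independent (simple_extension K b) us"
    using independent_imp_trivial_combine_sym[OF K F us] independent_in_carrier[OF us(2)]
    by (intro trivial_combine_imp_independent[OF Kb]) auto
qed

text \<open>
  The hypothesis of relative closedness of \<open>K\<close> in \<open>F\<close> passes to \<open>K[b]\<close> in \<open>F[b]\<close>. Write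
  \<open>a = f(b)\<close> with \<open>f\<close> over \<open>F\<close> of degree less than the degree \<open>n\<close> of \<open>b\<close> over \<open>F\<close>. At each of the
  \<open>n\<close> conjugates of \<open>b\<close> over \<open>F\<close>, the value of \<open>f\<close> is a conjugate of \<open>a\<close> and so belongs to the
  field \<open>S\<close> of separable elements. By interpolation \<open>f\<close> has coefficients in \<open>S \<inter> F \<subseteq> K\<close>.
\<close>

lemma (in algebraically_closed) sep_closed_simple_extension:
  assumes K: "subfield K L" and F: "subfield F L" "K \<subseteq> F"
    and closed: "\<And>a. a \<in> F \<Longrightarrow> frob_sep K a \<Longrightarrow> a \<in> K"
    and b: "b \<in> carrier L" "frob_sep K b"
    and a: "a \<in> simple_extension F b" "frob_sep K a"
  shows "a \<in> simple_extension K b"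
proof -
  note K_ring = subfieldE(1)[OF K] and F_ring = subfieldE(1)[OF F(1)] and F_carr = subfieldE(3)[OF F(1)]
  define S where "S = {x \<in> carrier L. frob_sep K x}"
  have S: "subfield S L" unfolding S_def by (rule subfield_of_frob_sep[OF K])
  have SF: "S \<inter> F \<subseteq> K" using closed by (auto simp: S_def)
  have alg: "(algebraic over K) b" using b(2) by (simp add: frob_sep_def)
  have algF: "(algebraic over F) b" by (rule algebraic_mono[OF F(2) alg])
  define g where "g = Irr F b"
  note g = IrrE[OF F(1) b(1) algF, folded g_def] and Irr = IrrE[OF K b(1) alg]
  have g_carr: "g \<in> carrier (poly_ring L)" by (rule carrier_polynomial_shell[OF F_ring g(1)])
  have Irr_carr: "Irr K b \<in> carrier (poly_ring L)" by (rule carrier_polynomial_shell[OF K_ring Irr(1)])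
  have Irr0: "Irr K b \<noteq> []" by (rule pirreducibleE(1)[OF K_ring Irr(1,2)])
  have IrrF: "Irr K b \<in> carrier (F[X])"
    using Irr(1) F(2) unfolding univ_poly_carrier[symmetric] polynomial_def by auto
  have dvd: "g pdivides Irr K b"
    unfolding g_def by (rule Irr_minimal[OF F(1) b(1) algF IrrF Irr(4)])
  define A where "A = set_mset (roots g)"
  have A_root: "y \<in> carrier L" "eval g y = \<zero>" if "y \<in> A" for y
    using that roots_mem_iff_is_root[OF g_carr] by (auto simp: is_root_def A_def)
  have A_S: "A \<subseteq> S"
  proof
    fix y assume y: "y \<in> A"
    then have "eval (Irr K b) y = \<zero>"
      using pdivides_imp_root_sharing[OF g_carr dvd] A_root by blast
    then show "y \<in> S" unfolding S_def using frob_sep_conjugate[OF K b] A_root[OF y] by blast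
  qed
  \<comment> \<open>Separability of \<open>b\<close> makes the number of nodes equal to the degree.\<close>
  have "count (roots g) y = 1" if y: "y \<in> A" for y
  proof -
    have "separable_algebraic K b" using separable_algebraic_iff_frob_sep[OF K] b by blast
    then have "count (roots (Irr K b)) y \<le> 1"
      using A_root(1)[OF y] alg_mult_eq_count_roots[OF Irr_carr] by (simp add: separable_algebraic_def)
    moreover have "count (roots g) y \<le> count (roots (Irr K b)) y"
      by (rule mset_subset_eq_count[OF pdivides_imp_roots_incl[OF g_carr Irr_carr Irr0 dvd]])
    moreover have "count (roots g) y > 0" using y by (simp add: A_def)
    ultimately show ?thesis by linarith
  qed
  then have "size (roots g) = card A"
    unfolding size_multiset_overloaded_eq A_def by simp
  then have card: "card A = degree g"
    using roots_over_carrier[OF g_carr] by (simp add: splitted_def)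
  have "a \<in> Span F (exp_base b (degree g))"
    unfolding g_def Span_exp_base[OF F(1) b(1) algF] by (rule a(1))
  then obtain f where f: "f \<in> carrier (F[X])" "length f \<le> degree g" "eval f b = a"
    unfolding Span_eq_eval_img[OF F(1) b(1)] by auto
  have f_carr: "f \<in> carrier (poly_ring L)" by (rule carrier_polynomial_shell[OF F_ring f(1)])
  have a_carr: "a \<in> carrier L"
    using a(1) simple_extension_in_carrier[OF F_carr b(1)] by auto
  have alg_a: "(algebraic over K) a" using a(2) by (simp add: frob_sep_def)
  note Irr_a = IrrE[OF K a_carr alg_a]
  have Irr_a_K: "set (Irr K a) \<subseteq> K" by (rule univ_poly_coeffs[OF Irr_a(1)])
  then have Irr_a_carr: "set (Irr K a) \<subseteq> carrier L" using subfieldE(3)[OF K] by auto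
  define h where "h = poly_compose (Irr K a) f"
  have h: "h \<in> carrier (F[X])"
    unfolding h_def using Irr_a_K F(2) by (intro poly_compose_closed[OF F_ring _ f(1)]) auto
  have eval_h: "eval h y = eval (Irr K a) (eval f y)" if "y \<in> carrier L" for y
    unfolding h_def by (rule eval_poly_compose[OF Irr_a_carr f_carr that])
  have "g pdivides h"
    unfolding g_def using eval_h[OF b(1)] f(3) Irr_a(4)
    by (intro Irr_minimal[OF F(1) b(1) algF h]) simp
  then have "eval f y \<in> S" if y: "y \<in> A" for y
  proof -
    have "eval h y = \<zero>"
      using pdivides_imp_root_sharing[OF g_carr \<open>g pdivides h\<close>] A_root[OF y] by blast
    moreover have "eval f y \<in> carrier L"
      using eval_in_carrier[OF univ_poly_coeffs[OF f_carr]] A_root(1)[OF y] by blast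
    ultimately show ?thesis
      unfolding S_def using frob_sep_conjugate[OF K a_carr a(2)] eval_h[OF A_root(1)[OF y]] by simp
  qed
  then have "f \<in> carrier (S[X])"
    using f(2) card A_S by (intro interpolation_coeffs_mem[OF S f_carr, of A]) (auto simp: A_def)
  then have "set f \<subseteq> K"
    using univ_poly_coeffs[of f S] univ_poly_coeffs[OF f(1)] SF by blast
  then have "set f \<subseteq> simple_extension K b"
    using simple_extension_incl[OF subfieldE(3)[OF K] b(1)] by blast
  then show ?thesis
    using eval_mem_subring[OF simple_extension_is_subring[OF K_ring b(1)] _ simple_extension_mem[OF K_ring b(1)]]
      f(3) by blast
qed

lemma (in algebraically_closed) independent_finite_separable_extension:
  "\<lbrakk>subfield K L; subfield F L; K \<subseteq> F; \<And>a. a \<in> F \<Longrightarrow> frob_sep K a \<Longrightarrow> a \<in> K;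
    set xs \<subseteq> carrier L; \<And>x. x \<in> set xs \<Longrightarrow> frob_sep K x; set us \<subseteq> F; independent K us\<rbrakk>
    \<Longrightarrow> independent (finite_extension K xs) us"
proof (induction xs arbitrary: K F rule: rev_induct)
  case Nil
  then show ?case by simp
next
  case (snoc b xs)
  note K = snoc.prems(1) and F = snoc.prems(2,3) and closed = snoc.prems(4)
  have b: "b \<in> carrier L" "frob_sep K b" using snoc.prems(5,6) by auto
  have alg: "(algebraic over K) b" using b(2) by (simp add: frob_sep_def)
  define K' F' where "K' = simple_extension K b" and "F' = simple_extension F b"
  have K': "subfield K' L"
    unfolding K'_def using simple_extension_is_subfield[OF K b(1)] alg by simp
  have F': "subfield F' L"
    unfolding F'_def using simple_extension_is_subfield[OF F(1) b(1)] algebraic_mono[OF F(2) alg] by simp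
  have KK': "K \<subseteq> K'" unfolding K'_def by (rule simple_extension_incl[OF subfieldE(3)[OF K] b(1)])
  have FF': "F \<subseteq> F'" unfolding F'_def by (rule simple_extension_incl[OF subfieldE(3)[OF F(1)] b(1)])
  have sepK': "frob_sep K x" if "x \<in> K'" for x
    using frob_sep_finite_extension[OF K, of "[b]" x] that b by (simp add: K'_def finite_extension_Cons)
  have "independent K' us"
  proof -
    have "linearly_disjoint K F K'"
      unfolding K'_def
    proof (rule linearly_disjoint_simple_extension[OF K F subfield_of_frob_sep[OF K] _ b(1) alg])
      show "{x \<in> carrier L. frob_sep K x} \<inter> F \<subseteq> K" using closed by auto
      show "y \<in> {x \<in> carrier L. frob_sep K x}" if "y \<in> carrier L" "eval (Irr K b) y = \<zero>" for y
        using frob_sep_conjugate[OF K b that] that(1) by simp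
    qed
    then show ?thesis using snoc.prems(7,8) by (simp add: linearly_disjoint_def)
  qed
  have "independent (finite_extension K' xs) us"
  proof (rule snoc.IH[OF K' F'])
    show "K' \<subseteq> F'" unfolding K'_def F'_def by (rule mono_simple_extension[OF F(2)])
    show "a \<in> K'" if "a \<in> F'" "frob_sep K' a" for a
    proof -
      have "a \<in> carrier L" using that(1) subfieldE(3)[OF F'] by auto
      then have "frob_sep K a" using frob_sep_trans[OF K K' KK' sepK'] that(2) by blast
      then show ?thesis
        using sep_closed_simple_extension[OF K F closed b] that(1) unfolding K'_def F'_def by blast
    qed
    show "frob_sep K' x" if "x \<in> set xs" for x
      using frob_sep_mono[OF KK'] snoc.prems(6) that by auto
    show "set xs \<subseteq> carrier L" using snoc.prems(5) by auto
    show "set us \<subseteq> F'" using snoc.prems(7) FF' by auto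
    show "independent K' us" by fact
  qed
  then show ?case by (simp add: K'_def finite_extension.simps)
qed

lemma (in algebraically_closed) linearly_disjoint_separable_extension:
  assumes K: "subfield K L" and F: "subfield F L" "K \<subseteq> F"
    and closed: "\<And>a. a \<in> F \<Longrightarrow> frob_sep K a \<Longrightarrow> a \<in> K"
    and M: "subfield M L" "\<And>x. x \<in> M \<Longrightarrow> frob_sep K x"
  shows "linearly_disjoint K F M"
  unfolding linearly_disjoint_def
proof (intro allI impI)
  fix us assume us: "set us \<subseteq> F" "independent K us"
  show "independent M us"
  proof (rule trivial_combine_imp_independent[OF M(1) independent_in_carrier[OF us(2)]])
    fix cs assume cs: "set cs \<subseteq> M" "combine cs us = \<zero>"
    have carr: "set cs \<subseteq> carrier L" using cs(1) subfieldE(3)[OF M(1)] by auto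
    have sep: "frob_sep K c" if "c \<in> set cs" for c using that cs(1) M(2) by auto
    have "subfield (finite_extension K cs) L"
      using finite_extension_is_subfield[OF K carr] sep by (auto simp: frob_sep_def)
    moreover have "independent (finite_extension K cs) us"
      by (rule independent_finite_separable_extension[OF K F closed carr sep us])
    ultimately show "set (take (length us) cs) \<subseteq> {\<zero>}"
      using independent_imp_trivial_combine finite_extension_mem[OF subfieldE(1)[OF K] carr] cs(2)
      by blast
  qed
qed

lemma (in ring) Span_subset_subring:
  assumes K: "subfield K R" and E: "subring E R" "K \<subseteq> E" and us: "set us \<subseteq> E"
  shows "Span K us \<subseteq> E"
proof -
  have carr: "set us \<subseteq> carrier R" using us subringE(1)[OF E(1)] by auto
  show ?thesis
    using combine_mem[OF E(1) _ us] E(2) unfolding Span_eq_combine_set[OF K carr] by blast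
qed

text \<open>
  If \<open>z\<close> were independent of a \<open>K\<close>-basis of the span of \<open>ws\<close>, it would stay so over \<open>F\<close>.
\<close>

lemma (in domain) linearly_disjoint_Span_descent:
  assumes K: "subfield K R" and F: "subfield F R" "K \<subseteq> F" and S: "subfield S R" "K \<subseteq> S"
    and disj: "linearly_disjoint K S F"
    and ws: "set ws \<subseteq> S" and z: "z \<in> S" "z \<in> Span F ws"
  shows "z \<in> Span K ws"
proof -
  have ws_carr: "set ws \<subseteq> carrier R" using ws subfieldE(3)[OF S(1)] by auto
  obtain vs where vs: "set vs \<subseteq> carrier R" "independent K vs" "Span K vs = Span K ws"
    using filter_base[OF K ws_carr] by blast
  have vs_S: "set vs \<subseteq> S"
    using Span_base_incl[OF K vs(1)] Span_subset_subring[OF K subfieldE(1)[OF S(1)] S(2) ws] vs(3)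
    by blast
  have "set ws \<subseteq> Span F vs"
    using Span_base_incl[OF K ws_carr] vs(3) Span_mono_subset[OF F(2), of vs] by blast
  then have zF: "z \<in> Span F vs" using mono_Span_subset[OF F(1) _ vs(1)] z(2) by blast
  show ?thesis
  proof (rule ccontr)
    assume "z \<notin> Span K ws"
    then have "independent K (z # vs)"
      using vs z(1) subfieldE(3)[OF S(1)] by (intro li_Cons) auto
    moreover have "set (z # vs) \<subseteq> S" using vs_S z(1) by simp
    ultimately have "independent F (z # vs)"
      using disj by (simp add: linearly_disjoint_def)
    then show False using independent_backwards(1) zF by blast
  qed
qed

text \<open>
  The union of these spans is a ring that is algebraic over the field \<open>F\<close>, hence a field.
\<close>

lemma (in field) compositum_mem_Span:
  assumes F: "subfield F R" and M: "subfield M R" "\<And>x. x \<in> M \<Longrightarrow> (algebraic over F) x"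
    and x: "x \<in> generate_field R (M \<union> F)"
  obtains ls where "set ls \<subseteq> M" "x \<in> Span F ls"
proof -
  note F_carr = subfieldE(3)[OF F] and M_carr = subfieldE(3)[OF M(1)] and M_ring = subfieldE(1)[OF M(1)]
  define T where "T = {x. \<exists>ls. set ls \<subseteq> M \<and> x \<in> Span F ls}"
  have T_carr: "T \<subseteq> carrier R" using Span_in_carrier[OF F_carr] M_carr by (fastforce simp: T_def)
  have FT: "F \<subseteq> T"
  proof
    fix k assume k: "k \<in> F"
    have "\<one> \<in> Span F [\<one>]" using Span_base_incl[OF F, of "[\<one>]"] by simp
    then have "k \<otimes> \<one> \<in> Span F [\<one>]" using F k by simp
    then show "k \<in> T"
      unfolding T_def using subringE(3)[OF M_ring] k F_carr by (intro CollectI exI[of _ "[\<one>]"]) auto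
  qed
  have MT: "M \<subseteq> T"
  proof
    fix y assume y: "y \<in> M"
    then have "y \<in> Span F [y]" using Span_base_incl[OF F, of "[y]"] M_carr by auto
    then show "y \<in> T" unfolding T_def using y by (intro CollectI exI[of _ "[y]"]) auto
  qed
  have T_ring: "subring T R"
  proof (rule subringI)
    show "T \<subseteq> carrier R" by (rule T_carr)
    show "\<one> \<in> T" using FT subringE(3)[OF subfieldE(1)[OF F]] by auto
  next
    fix x assume "x \<in> T"
    then obtain us where us: "set us \<subseteq> M" "x \<in> Span F us" by (auto simp: T_def)
    then have "\<ominus> x \<in> Span F us" using F M_carr by simp
    then show "\<ominus> x \<in> T" using us(1) by (auto simp: T_def)
  next
    fix x y assume "x \<in> T" "y \<in> T"
    then obtain us vs where us: "set us \<subseteq> M" "x \<in> Span F us" and vs: "set vs \<subseteq> M" "y \<in> Span F vs"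
      by (auto simp: T_def)
    have carr: "set us \<subseteq> carrier R" "set vs \<subseteq> carrier R" using us(1) vs(1) M_carr by auto
    have "x \<in> Span F (us @ vs)" "y \<in> Span F (us @ vs)"
      using mono_Span_append[OF F] carr us(2) vs(2) by blast+
    then have "x \<oplus> y \<in> Span F (us @ vs)" using F carr by simp
    then show "x \<oplus> y \<in> T" using us(1) vs(1) unfolding T_def by (intro CollectI exI[of _ "us @ vs"]) auto
    \<comment> \<open>Products of the generators span the products of the spans.\<close>
    define ws where "ws = map (\<lambda>(u, v). u \<otimes> v) (List.product us vs)"
    have ws_M: "set ws \<subseteq> M" using us(1) vs(1) subringE(6)[OF M_ring] by (auto simp: ws_def)
    then have ws_carr: "set ws \<subseteq> carrier R" using M_carr by auto
    have "u \<otimes> v \<in> Span F ws" if uv: "u \<in> set us" "v \<in> set vs" for u v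
    proof -
      have "u \<otimes> v \<in> set ws" using uv by (force simp: ws_def)
      then show ?thesis using Span_base_incl[OF F ws_carr] by blast
    qed
    then have "x \<otimes> y \<in> Span F ws"
      using Span_mult_mem[OF F carr ws_carr _ us(2) vs(2)] by blast
    then show "x \<otimes> y \<in> T" using ws_M by (auto simp: T_def)
  qed
  have T_alg: "(algebraic over F) y" if y: "y \<in> T" for y
  proof -
    let ?A = "{x \<in> carrier R. (algebraic over F) x}"
    obtain ls where ls: "set ls \<subseteq> M" "y \<in> Span F ls" using y by (auto simp: T_def)
    have A: "subring ?A R" by (rule subfieldE(1)[OF subfield_of_algebraics[OF F]])
    have "F \<subseteq> ?A" using algebraic_self[OF subfieldE(1)[OF F]] F_carr by auto
    moreover have "set ls \<subseteq> ?A" using ls(1) M_carr M(2) by auto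
    ultimately show ?thesis using Span_subset_subring[OF F A] ls(2) by blast
  qed
  have T: "subfield T R"
  proof (rule subfieldI'[OF T_ring])
    fix y assume y: "y \<in> T - {\<zero>}"
    have y_carr: "y \<in> carrier R" using y T_carr by auto
    have "subfield (simple_extension F y) R"
      using simple_extension_is_subfield[OF F y_carr] T_alg y by simp
    then have "inv y \<in> simple_extension F y"
      using subfield_m_inv(1)[of "simple_extension F y" y] simple_extension_mem[OF subfieldE(1)[OF F] y_carr] y
      by auto
    moreover have "simple_extension F y \<subseteq> T"
      using y by (intro simple_extension_subring_incl[OF T_ring FT]) simp
    ultimately show "inv y \<in> T" by blast
  qed
  have "generate_field R (M \<union> F) \<subseteq> T"
    using M_carr F_carr MT FT by (intro generate_field_min_subfield1[OF _ T]) auto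
  then show thesis using that x by (auto simp: T_def)
qed

lemma (in field) algebraic_list_imp_frob_funpow_sep:
  assumes K: "subfield K R"
  shows "set xs \<subseteq> carrier R \<Longrightarrow> (\<And>x. x \<in> set xs \<Longrightarrow> (algebraic over K) x) \<Longrightarrow>
    \<exists>n. \<forall>x\<in>set xs. frob_sep K ((frob ^^ n) x)"
proof (induction xs)
  case (Cons y ys)
  then obtain m where m: "\<forall>x\<in>set ys. frob_sep K ((frob ^^ m) x)" by auto
  obtain n where n: "frob_sep K ((frob ^^ n) y)"
    using algebraic_imp_frob_funpow_sep[OF K, of y] Cons.prems by auto
  have "frob_sep K ((frob ^^ (m + n)) x)" if "x \<in> set (y # ys)" for x
  proof -
    have x: "x \<in> carrier R" using that Cons.prems(1) by auto
    have "frob_sep K ((frob ^^ n) x) \<or> frob_sep K ((frob ^^ m) x)" using that m n by auto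
    then show ?thesis
    proof
      assume "frob_sep K ((frob ^^ n) x)"
      then have "frob_sep K ((frob ^^ m) ((frob ^^ n) x))" using frob_sep_funpow[OF K] x by simp
      then show ?thesis by (simp add: funpow_add)
    next
      assume "frob_sep K ((frob ^^ m) x)"
      then have "frob_sep K ((frob ^^ n) ((frob ^^ m) x))" using frob_sep_funpow[OF K] x by simp
      then show ?thesis by (simp add: funpow_add add.commute[of m])
    qed
  qed
  then show ?case by blast
qed simp

lemma (in domain) frob_funpow_combine:
  assumes "set ks \<subseteq> carrier R" "set us \<subseteq> carrier R"
  shows "(frob ^^ n) (combine ks us) = combine (map (frob ^^ n) ks) (map (frob ^^ n) us)"
proof -
  interpret h: ring_hom_ring R R "frob ^^ n"
    using ring_hom_ringI2[OF ring_axioms ring_axioms frob_funpow_ring_hom] .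
  show ?thesis using h.combine_hom[OF assms] by simp
qed

lemma (in field) frob_funpow_preserves_independent:
  assumes K: "subfield K R"
  shows "independent K us \<Longrightarrow> (\<And>x. x \<in> set us \<Longrightarrow> frob_sep K x) \<Longrightarrow> independent K (map (frob ^^ n) us)"
proof (induction n)
  case (Suc n)
  have carr: "set us \<subseteq> carrier R" using independent_in_carrier[OF Suc.prems(1)] .
  have "independent K (map frob (map (frob ^^ n) us))"
    using Suc.prems frob_sep_funpow[OF K] carr
    by (intro frob_preserves_independent_of_sep[OF K Suc.IH]) auto
  then show ?case by (simp add: comp_def)
qed simp

lemma (in ring) frob_funpow_eq_pow: "x \<in> carrier R \<Longrightarrow> (frob ^^ n) x = x [^] (char_exp ^ n)"
  by (induction n) (simp_all add: frob_def nat_pow_pow mult.commute)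

lemma (in domain) frob_funpow_mem_imp_algebraic:
  assumes K: "subring K R" and x: "x \<in> carrier R" "(frob ^^ n) x \<in> K"
  shows "(algebraic over K) x"
proof -
  have "char_exp ^ n > 0" using char_exp_pos by simp
  then obtain q where q: "q \<in> carrier (K[X])" "q \<noteq> []"
    "eval q x = x [^] (char_exp ^ n) \<ominus> (frob ^^ n) x"
    using obtain_power_minus_const[OF K x(2)] x(1) by metis
  then have "eval q x = \<zero>" using x(1) by (simp add: frob_funpow_eq_pow a_minus_def r_neg)
  then show ?thesis using algebraicI q(1,2) by blast
qed

text \<open>
  Some \<open>\<phi>^n\<close> moves \<open>a\<close> and the elements of \<open>M\<close> from which it is formed into the field \<open>S\<close> of
  elements separable over \<open>K\<close>. There \<open>\<phi>^n a\<close> lies in an \<open>F\<close>-span, hence already in the \<open>K\<close>-span,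
  which is contained in \<open>M\<close>.
\<close>

lemma (in algebraically_closed) separable_in_compositum:
  assumes K: "subfield K L" and F: "subfield F L" "K \<subseteq> F"
    and closed: "\<And>a. a \<in> F \<Longrightarrow> frob_sep K a \<Longrightarrow> a \<in> K"
    and M: "subfield M L" "K \<subseteq> M" "\<And>x. x \<in> M \<Longrightarrow> (algebraic over K) x"
    and a: "a \<in> generate_field L (M \<union> F)" "frob_sep M a"
  shows "a \<in> M"
proof -
  note F_carr = subfieldE(3)[OF F(1)] and M_carr = subfieldE(3)[OF M(1)]
  have a_carr: "a \<in> carrier L"
    using a(1) generate_field_in_carrier[of "M \<union> F" a] M_carr F_carr by auto
  have alg_a: "(algebraic over K) a"
    using algebraic_trans[OF K M(1) M(3) a_carr] a(2) by (simp add: frob_sep_def)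
  define S where "S = {x \<in> carrier L. frob_sep K x}"
  have S: "subfield S L" unfolding S_def by (rule subfield_of_frob_sep[OF K])
  have KS: "K \<subseteq> S" using frob_sep_self[OF K] subfieldE(3)[OF K] by (auto simp: S_def)
  have "linearly_disjoint K F S"
    by (rule linearly_disjoint_separable_extension[OF K F closed S]) (auto simp: S_def)
  then have disj: "linearly_disjoint K S F" by (rule linearly_disjoint_sym[OF K S KS F])
  obtain ls where ls: "set ls \<subseteq> M" "a \<in> Span F ls"
    using compositum_mem_Span[OF F(1) M(1) _ a(1)] algebraic_mono[OF F(2)] M(3) by blast
  have ls_carr: "set ls \<subseteq> carrier L" using ls(1) M_carr by auto
  obtain n where n: "\<forall>x\<in>set (a # ls). frob_sep K ((frob ^^ n) x)"
    using algebraic_list_imp_frob_funpow_sep[OF K, of "a # ls"] a_carr alg_a ls_carr ls(1) M(3) by auto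
  define ws where "ws = map (frob ^^ n) ls"
  have ws_M: "set ws \<subseteq> M" using ls(1) frob_funpow_mem_subring[OF subfieldE(1)[OF M(1)]] by (auto simp: ws_def)
  have ws_S: "set ws \<subseteq> S" using n ls_carr by (auto simp: ws_def S_def)
  have ws_carr: "set ws \<subseteq> carrier L" using ws_M M_carr by auto
  obtain fs where fs: "set fs \<subseteq> F" "a = combine fs ls"
    using ls(2) Span_eq_combine_set[OF F(1) ls_carr] by auto
  have "(frob ^^ n) a = combine (map (frob ^^ n) fs) ws"
    unfolding fs(2) ws_def using fs(1) F_carr by (intro frob_funpow_combine ls_carr) auto
  moreover have "set (map (frob ^^ n) fs) \<subseteq> F"
    using fs(1) frob_funpow_mem_subring[OF subfieldE(1)[OF F(1)]] by auto
  ultimately have "(frob ^^ n) a \<in> Span F ws"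
    unfolding Span_eq_combine_set[OF F(1) ws_carr] by blast
  moreover have "(frob ^^ n) a \<in> S" using n a_carr by (simp add: S_def)
  ultimately have "(frob ^^ n) a \<in> Span K ws"
    using linearly_disjoint_Span_descent[OF K F S KS disj ws_S] by blast
  then have "(frob ^^ n) a \<in> M"
    using Span_subset_subring[OF K subfieldE(1)[OF M(1)] M(2) ws_M] by blast
  then show ?thesis using frob_sep_funpow_mem_imp_mem[OF M(1) a_carr a(2)] by blast
qed

text \<open>
  Here \<open>a\<close> need not be separable over \<open>M\<close>, so \<open>\<phi>^n a \<in> M\<close> is not enough. Write \<open>a\<close> with
  coefficients \<open>fs\<close> in \<open>F\<close> in terms of \<open>K\<close>-independent elements \<open>vs\<close> of \<open>M\<close>. As \<open>M\<close> is separable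
  over \<open>K\<close>, the \<open>\<phi>^n v\<close> are independent over \<open>K\<close> and, by linear disjointness, over \<open>F\<close>. So the
  expansions of \<open>\<phi>^n a\<close> over \<open>F\<close> and over \<open>K\<close> coincide and \<open>\<phi>^n f \<in> K\<close> for the coefficients.
\<close>

lemma (in algebraically_closed) algebraic_in_compositum:
  assumes K: "subfield K L" and F: "subfield F L" "K \<subseteq> F"
    and closed: "\<And>a. a \<in> F \<Longrightarrow> (algebraic over K) a \<Longrightarrow> a \<in> K"
    and M: "subfield M L" "K \<subseteq> M" "\<And>x. x \<in> M \<Longrightarrow> frob_sep K x"
    and a: "a \<in> generate_field L (M \<union> F)" "(algebraic over M) a"
  shows "a \<in> M"
proof -
  note F_carr = subfieldE(3)[OF F(1)] and M_carr = subfieldE(3)[OF M(1)]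
  have algM: "(algebraic over K) x" if "x \<in> M" for x using M(3)[OF that] by (simp add: frob_sep_def)
  have a_carr: "a \<in> carrier L"
    using a(1) generate_field_in_carrier[of "M \<union> F" a] M_carr F_carr by auto
  have alg_a: "(algebraic over K) a" by (rule algebraic_trans[OF K M(1) algM a_carr a(2)])
  define S where "S = {x \<in> carrier L. frob_sep K x}"
  have S: "subfield S L" unfolding S_def by (rule subfield_of_frob_sep[OF K])
  have KS: "K \<subseteq> S" using frob_sep_self[OF K] subfieldE(3)[OF K] by (auto simp: S_def)
  have "linearly_disjoint K F S"
    using closed by (intro linearly_disjoint_separable_extension[OF K F _ S]) (auto simp: S_def frob_sep_def)
  then have disj: "linearly_disjoint K S F" by (rule linearly_disjoint_sym[OF K S KS F])
  obtain ls where ls: "set ls \<subseteq> M" "a \<in> Span F ls"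
    using compositum_mem_Span[OF F(1) M(1) _ a(1)] algebraic_mono[OF F(2)] algM by blast
  have ls_carr: "set ls \<subseteq> carrier L" using ls(1) M_carr by auto
  obtain vs where vs: "set vs \<subseteq> carrier L" "independent K vs" "Span K vs = Span K ls"
    using filter_base[OF K ls_carr] by blast
  have vs_M: "set vs \<subseteq> M"
    using Span_base_incl[OF K vs(1)] Span_subset_subring[OF K subfieldE(1)[OF M(1)] M(2) ls(1)] vs(3)
    by blast
  have "set ls \<subseteq> Span F vs"
    using Span_base_incl[OF K ls_carr] vs(3) Span_mono_subset[OF F(2), of vs] by blast
  then have "a \<in> Span F vs" using mono_Span_subset[OF F(1) _ vs(1)] ls(2) by blast
  then obtain fs where fs: "set fs \<subseteq> F" "length fs = length vs" "a = combine fs vs"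
    using Span_mem_iff_length_version[OF F(1) vs(1)] by auto
  obtain n where n: "frob_sep K ((frob ^^ n) a)"
    using algebraic_imp_frob_funpow_sep[OF K a_carr alg_a] by blast
  define ws where "ws = map (frob ^^ n) vs"
  have vs_sep: "frob_sep K v" if "v \<in> set vs" for v using that vs_M M(3) by auto
  have ws_carr: "set ws \<subseteq> carrier L" using vs(1) by (auto simp: ws_def)
  have ws_S: "set ws \<subseteq> S" using vs_sep vs(1) frob_sep_funpow[OF K] by (auto simp: ws_def S_def)
  have "independent K ws"
    unfolding ws_def by (rule frob_funpow_preserves_independent[OF K vs(2) vs_sep])
  then have ws_F: "independent F ws" using disj ws_S by (simp add: linearly_disjoint_def)
  have comb: "(frob ^^ n) a = combine (map (frob ^^ n) fs) ws"
    unfolding fs(3) ws_def using fs(1) F_carr by (intro frob_funpow_combine vs(1)) auto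
  have fs_F: "set (map (frob ^^ n) fs) \<subseteq> F"
    using fs(1) frob_funpow_mem_subring[OF subfieldE(1)[OF F(1)]] by auto
  have in_Span: "(frob ^^ n) a \<in> Span F ws"
    using comb fs_F unfolding Span_eq_combine_set[OF F(1) ws_carr] by blast
  moreover have "(frob ^^ n) a \<in> S" using n a_carr by (simp add: S_def)
  ultimately have "(frob ^^ n) a \<in> Span K ws"
    using linearly_disjoint_Span_descent[OF K F S KS disj ws_S] by blast
  then obtain ks where ks: "set ks \<subseteq> K" "length ks = length ws" "(frob ^^ n) a = combine ks ws"
    using Span_mem_iff_length_version[OF K ws_carr] by blast
  have "map (frob ^^ n) fs = ks"
    using unique_decomposition[OF F(1) ws_F in_Span] ks comb fs_F F(2) fs(2)
    by (metis length_map ws_def subset_trans)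
  then have "(frob ^^ n) f \<in> K" if "f \<in> set fs" for f using that ks(1) by auto
  then have "set fs \<subseteq> K"
    using closed fs(1) F_carr frob_funpow_mem_imp_algebraic[OF subfieldE(1)[OF K]] by (meson subset_iff)
  then show ?thesis
    unfolding fs(3) using M(2) vs_M by (intro combine_mem[OF subfieldE(1)[OF M(1)]]) auto
qed

lemma (in ring) linearly_disjoint_mono_right:
  assumes "E' \<subseteq> E''" and "linearly_disjoint K E E''" shows "linearly_disjoint K E E'"
  using assms independent_mono by (auto simp: linearly_disjoint_def)

section \<open>Relative algebraic closedness and linear disjointness\<close>

theorem lemma2p1:
  fixes \<Omega> :: "('a, 'b) ring_scheme" and K F L :: "'a set"
  assumes "algebraic_closure \<Omega> F"
    and "subfield K \<Omega>" and "K \<subseteq> F"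
    and "subfield L \<Omega>" and "ring.algebraic_ext \<Omega> K L"
  shows
    "(\<forall>b \<in> carrier \<Omega>.
        ring.rel_alg_closed \<Omega> K F \<and> (ring.algebraic \<Omega> over K) b \<or>
        algebraically_closed.rel_sep_alg_closed \<Omega> K F \<and>
          algebraically_closed.separable_algebraic \<Omega> K b
        \<longrightarrow> ring.linearly_disjoint \<Omega> K F (generate_field \<Omega> (insert b K))) \<and>
     (algebraically_closed.rel_sep_alg_closed \<Omega> K F \<and>
        algebraically_closed.separable_algebraic_ext \<Omega> K L
        \<longrightarrow> ring.linearly_disjoint \<Omega> K F L) \<and>
     (ring.rel_alg_closed \<Omega> K F \<and>
        algebraically_closed.separable_algebraic_ext \<Omega> K L
        \<longrightarrow> ring.rel_alg_closed \<Omega> L (generate_field \<Omega> (L \<union> F))) \<and>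
     (algebraically_closed.rel_sep_alg_closed \<Omega> K F
        \<longrightarrow> algebraically_closed.rel_sep_alg_closed \<Omega> L (generate_field \<Omega> (L \<union> F)))"
proof -
  interpret algebraic_closure \<Omega> F by fact
  note K = \<open>subfield K \<Omega>\<close> and KF = \<open>K \<subseteq> F\<close> and L = \<open>subfield L \<Omega>\<close>
  have F: "subfield F \<Omega>" by (rule subfield_axioms)
  note F_carr = subfieldE(3)[OF F] and L_carr = subfieldE(3)[OF L]
  have KL: "K \<subseteq> L" and algL: "\<And>x. x \<in> L \<Longrightarrow> (algebraic over K) x"
    using \<open>algebraic_ext K L\<close> by (auto simp: algebraic_ext_def)
  have sep_closedD: "a \<in> K" if "rel_sep_alg_closed K F" "a \<in> F" "frob_sep K a" for a
    using that separable_algebraic_iff_frob_sep[OF K] F_carr by (auto simp: rel_sep_alg_closed_def)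
  have sep_extD: "frob_sep K x" if "separable_algebraic_ext K L" "x \<in> L" for x
    using that separable_algebraic_iff_frob_sep[OF K] L_carr by (auto simp: separable_algebraic_ext_def)
  have LF_carr: "generate_field \<Omega> (L \<union> F) \<subseteq> carrier \<Omega>"
    using L_carr F_carr by (intro generate_field_incl) auto
  have "linearly_disjoint K F (generate_field \<Omega> (insert b K))"
    if b: "b \<in> carrier \<Omega>"
      and cases: "rel_alg_closed K F \<and> (algebraic over K) b \<or> rel_sep_alg_closed K F \<and> separable_algebraic K b"
    for b
  proof -
    have alg: "(algebraic over K) b" using cases by (auto simp: separable_algebraic_def)
    have "generate_field \<Omega> (insert b K) \<subseteq> simple_extension K b"
      using simple_extension_is_subfield[OF K b] alg simple_extension_incl[OF subfieldE(3)[OF K] b]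
        simple_extension_mem[OF subfieldE(1)[OF K] b] b subfieldE(3)[OF K]
      by (intro generate_field_min_subfield1) auto
    moreover have "linearly_disjoint K F (simple_extension K b)"
      using cases
    proof
      assume "rel_alg_closed K F \<and> (algebraic over K) b"
      then show ?thesis
        using Irr_root(1)[OF K b alg]
        by (intro linearly_disjoint_simple_extension[OF K F KF subfield_of_algebraics[OF K] _ b alg])
          (auto simp: rel_alg_closed_def)
    next
      assume *: "rel_sep_alg_closed K F \<and> separable_algebraic K b"
      then have "frob_sep K b" using separable_algebraic_iff_frob_sep[OF K b] by simp
      then show ?thesis
        using * sep_closedD frob_sep_conjugate[OF K b]
        by (intro linearly_disjoint_simple_extension[OF K F KF subfield_of_frob_sep[OF K] _ b alg]) auto
    qed
    ultimately show ?thesis by (rule linearly_disjoint_mono_right)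
  qed
  moreover have "linearly_disjoint K F L" if "rel_sep_alg_closed K F" "separable_algebraic_ext K L"
    using linearly_disjoint_separable_extension[OF K F KF sep_closedD[OF that(1)] L sep_extD[OF that(2)]] .
  moreover have "rel_alg_closed L (generate_field \<Omega> (L \<union> F))"
    if "rel_alg_closed K F" "separable_algebraic_ext K L"
    using algebraic_in_compositum[OF K F KF _ L KL sep_extD[OF that(2)]] that(1)
    unfolding rel_alg_closed_def by blast
  moreover have "rel_sep_alg_closed L (generate_field \<Omega> (L \<union> F))" if "rel_sep_alg_closed K F"
    unfolding rel_sep_alg_closed_def
    using separable_in_compositum[OF K F KF sep_closedD[OF that] L KL algL]
      separable_algebraic_iff_frob_sep[OF L] LF_carr by blast
  ultimately show ?thesis by blast
qed

end
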